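(* Consider the problem, the standing assumptions, and Algorithm 3 described in the context, run with a summable sequence $\{m^k\}$ of nonnegative numbers. Suppose there is $\underline\alpha>0$ with $\alpha_{\min}^k:=\min_{i\in[m]}\alpha_i^k\ge\underline\alpha$ for all $k\ge0$. Then $\{(\mathcal X^k,\mathcal S^k)\}$ converges to some $(\mathcal X^*,\mathcal S^* )\in\mathcal P^*\times\mathcal D^*$, the set of saddle points of $\mathcal L$. Moreover, for any given $(\mathcal X^*,\mathcal S^* )\in\mathcal P^*\times\mathcal D^*$ there exist a bounded set $\mathcal B_X\times\mathcal B_S\subseteq \mathbb R^{2m\times d}\times\mathbb R^{2m\times d}$ and $K'\ge1$ such that: (i) $(\mathcal X^*,\mathcal S^* )\in\mathcal B_X\times\mathcal B_S$ and $(\mathcal A^k,\mathcal S^k)\in\mathrm{int}(\mathcal B_X\times\mathcal B_S)$ for all $k\ge K'$; (ii) for all $k>K'$, $$\mathcal G_{\mathcal B_X\times\mathcal B_S}(\overline{\mathcal A}^k,\overline{\mathcal S}^k)\le\frac1{k-K'}\cdot\frac{C_{K'}+\Big(1+\alpha_{\min}^{K'-1}\sqrt{\tfrac{20}{\underline\alpha^2}+3}\Big)^2\mathcal V^{K'}_{\mathcal X^*\mathcal S^*}}{2\min\{\alpha_{\min}^{-1},\ \delta/(2\widetilde L^k)\}},$$ where $\alpha_{\min}^{-1}:=\min_i\alpha_i^{-1}$ is the smallest initial stepsize (superscripts on $\alpha$ are iteration indices), $\mathcal G_{\mathcal B_X\times\mathcal B_S}(\mathcal X,\mathcal S):=\max_{\mathcal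 S'\in\mathcal B_S}\mathcal L(\mathcal X,\mathcal S')-\min_{\mathcal X'\in\mathcal B_X}\mathcal L(\mathcal X',\mathcal S)$, $C_{K'}:=2\sum_{t=1}^{K'}\alpha_{\min}^{t-1}\mathcal G_{\mathcal B_X\times\mathcal B_S}(\mathcal A^t,\mathcal S^t)$, $\mathcal V^{K'}_{\mathcal X^*\mathcal S^*}:=\|\mathcal X^{K'}-\mathcal X^*\|^2+(\alpha_{\min}^{K'-1})^2\|\mathcal S^{K'}-\mathcal S^*\|^2$, $\widetilde L^k$ is the Lipschitz constant of $\nabla F$ over $\mathrm{conv}(\bigcup_{t=0}^{k-1}[\mathbf X^t,\mathbf A^{t+1}])$, and the ergodic averages start at $K'$: $\overline{\mathcal A}^k=\frac1{\theta^k}\sum_{t=K'+1}^k\alpha_{\min}^{t-1}\mathcal A^t$, $\overline{\mathcal S}^k=\frac1{\theta^k}\sum_{t=K'+1}^k\alpha_{\min}^{t-1}\mathcal S^t$, $\theta^k=\sum_{t=K'+1}^k\alpha_{\min}^{t-1}$.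
   Context: **Problem.** Minimize $u(x)=\sum_{i=1}^m f_i(x)+\sum_{i=1}^m r_i(x)$ over $x\in\mathbb R^d$. Assumptions: (i) each $f_i:\mathbb R^d\to\mathbb R$ is convex and locally smooth (differentiable with locally Lipschitz gradient); (ii) each $r_i:\mathbb R^d\to(-\infty,+\infty]$ is convex, proper, lower semicontinuous; (iii) $u$ is bounded below. **Notation.** For $\mathbf X\in\mathbb R^{m\times d}$ with rows $x_1^\top,\dots,x_m^\top$: $F(\mathbf X)=\sum_i f_i(x_i)$, $R(\mathbf X)=\sum_i r_i(x_i)$, and $\nabla F(\mathbf X)$ has rows $\nabla f_i(x_i)^\top$. Norms of matrices are Frobenius. $\mathrm{prox}_{\alpha h}(x)=\mathrm{argmin}_y\, h(y)+\frac1{2\alpha}\|x-y\|^2$; for $\Lambda=\mathrm{diag}(\alpha_1,\dots,\alpha_m)$, $\mathrm{prox}_{\Lambda,R}(\mathbf X)$ has $i$-th row $\mathrm{prox}_{\alpha_ir_i}(x_i)^\top$. $[\mathbf X,\mathbf A]$ is the segment between $\mathbf X$ and $\mathbf A$. **Network.** $\mathcal G=([m],\mathcal E)$ is an undirected connected graph, $\mathcal N_i=\{i\}\cup\{j:(i,j)\in\mathcal E\}$; $\widetilde W$ is a symmetric doubly stochastic $m\times m$ matrix with $\widetilde w_{ii}>0$, $\widetilde w_{ij}>0$ if $(i,j)\in\mathcal E$, and $\widetilde w_{ij}=0$ otherwise ($i\ne j$). For $c\in(0,1/2)$, $W=(1-c)I+c\widetilde W$; $Q:=(I-W)^{1/2}$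 and $M:=W^{1/2}$ (symmetric positive semidefinite roots). **Lagrangian.** For $\mathcal X=[\mathbf X;\widetilde{\mathbf X}]$, $\mathcal S=[\mathbf S;\widetilde{\mathbf S}]\in\mathbb R^{2m\times d}$: $\widetilde F(\mathcal X)=F(\mathbf X)$, $\widetilde R(\mathcal X)=R(\mathbf X)+\delta_{\{0\}}(\widetilde{\mathbf X})$, $\widetilde G(\mathcal X)=\delta_{\{0\}}(Q\mathbf X+M\widetilde{\mathbf X})$ ($\delta_{\{0\}}$ = indicator function of $\{0\}$), and $\mathcal L(\mathcal X,\mathcal S)=\widetilde F(\mathcal X)+\widetilde G(\mathcal X)+\langle\mathcal S,\mathcal X\rangle-\widetilde R^*(\mathcal S)$, with $\widetilde R^*$ the Fenchel conjugate. $\mathcal P^*\times\mathcal D^*$ is the set of saddle points of $\min_{\mathcal X}\max_{\mathcal S}\mathcal L(\mathcal X,\mathcal S)$. **Algorithm 3.** Parameters: $\alpha_i^{-1}>0$ (initial stepsizes, index $-1$), $\eta,\delta\in(0,1)$, a summable nonnegative sequence $\{m^k\}$. Initialization: $\mathbf X^0,\mathbf S^0\in\mathbb R^{m\times d}$ arbitrary, $\mathbf D^0=0$. Lower-case letters with index $i$ denote $i$-th rows. For $k=0,1,\dots$: 1. $\mathbf X^{k+1/2}=W\mathbf X^k$, $\mathbf D^{k+1/2}=W(\nabla F(\mathbf X^k)+\mathbf S^k+\mathbf D^k)$. 2. Each agent $i$ sets $\widetilde\alpha_i^k=\sqrt{(\alpha_i^{k-1})^2+m^k}$ and backtracks: $\alpha_i^k=\eta^j\widetilde\alpha_i^k$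 with $j\ge0$ the smallest integer such that, with $\alpha=\eta^j\widetilde\alpha_i^k$ and $x^+=x_i^{k+1/2}-\alpha d_i^{k+1/2}$, $f_i(x^+)\le f_i(x_i^k)+\langle\nabla f_i(x_i^k),x^+-x_i^k\rangle+\frac\delta{2\alpha}\|x^+-x_i^k\|^2$. 3. Local min-consensus: simultaneously for all $i$, $\alpha_i^k\leftarrow\min_{j\in\mathcal N_i}\alpha_j^k$; $\Lambda^k:=\mathrm{diag}(\alpha_1^k,\dots,\alpha_m^k)$ (these are the final values of $\alpha_i^k$). 4. $\mathbf D_\Lambda^k=(I-W)(\Lambda^k)^{-1}\mathbf X^k$. 5. $\mathbf A^{k+1}=\mathbf X^{k+1/2}-\Lambda^k\mathbf D^{k+1/2}$; $\mathbf X^{k+1}=\mathrm{prox}_{\Lambda^k,R}(\mathbf A^{k+1}+\Lambda^k\mathbf S^k)$; $\mathbf S^{k+1}=\mathbf S^k+(\Lambda^k)^{-1}(\mathbf A^{k+1}-\mathbf X^{k+1})$; $\mathbf D^{k+1}=\mathbf D^{k+1/2}+\mathbf D_\Lambda^k-\nabla F(\mathbf X^k)-\mathbf S^k$. **Lifted iterates.** $\mathbf Y^0=0$, $\mathbf Y^{k+1}=\mathbf Y^k+Q\big((\Lambda^k)^{-1}\mathbf X^k-\mathbf S^k-\mathbf D^k-\nabla F(\mathbf X^k)\big)$ (so $\mathbf D^k=Q\mathbf Y^k$); $\mathcal X^k=[\mathbf X^k;0]$, $\mathcal S^k=[\mathbf S^k;-M\mathbf Y^k]$, $\mathcal A^{k+1}=[\mathbf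 A^{k+1};\Lambda^kM(\mathbf Y^k-\mathbf Y^{k+1})]$.
   Formalization: The set of saddle points is additionally assumed to be nonempty; otherwise convergence fails, e.g. for m=d=1, f(x)=exp(-x), r=0, where the stepsizes stay bounded below but the iterates diverge. *)

theory Defs
  imports "HOL-Analysis.Analysis"
begin

text \<open>
  Agents are the elements of a finite type \<open>'m\<close>. An \<open>m \<times> d\<close> matrix is a term of type
  \<open>real^'d^'m\<close>: \<open>X $ i\<close> is its \<open>i\<close>-th row, and the norm and inner product of this type are the
  Frobenius ones. A stacked matrix \<open>[X; X']\<close> with \<open>2m\<close> rows is the pair \<open>(X, X')\<close>; norm, inner
  product and topology of the product type are those of the stacked matrix.
\<close>

subsection \<open>Convex analysis\<close>

definition grad :: "('a::real_inner \<Rightarrow> real) \<Rightarrow> 'a \<Rightarrow> 'a" where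
  "grad f x = (THE g. GDERIV f x :> g)"

definition locally_smooth :: "('a::real_inner \<Rightarrow> real) \<Rightarrow> bool" where
  "locally_smooth f \<longleftrightarrow>
     (\<forall>x. f differentiable (at x)) \<and>
     (\<forall>x. \<exists>e>0. \<exists>L. L-lipschitz_on (cball x e) (grad f))"

definition proper_fun :: "('a \<Rightarrow> ereal) \<Rightarrow> bool" where
  "proper_fun h \<longleftrightarrow> (\<forall>x. h x \<noteq> -\<infinity>) \<and> (\<exists>x. h x \<noteq> \<infinity>)"

text \<open>In \<^typ>\<open>ereal\<close> we have \<open>0 * \<infinity> = 0\<close>, so the endpoints \<open>u = 0\<close> and \<open>v = 0\<close> impose nothing.\<close>

definition convex_fun :: "('a::real_vector \<Rightarrow> ereal) \<Rightarrow> bool" where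
  "convex_fun h \<longleftrightarrow>
     (\<forall>x y. \<forall>u\<ge>0. \<forall>v\<ge>0. u + v = 1 \<longrightarrow>
        h (u *\<^sub>R x + v *\<^sub>R y) \<le> ereal u * h x + ereal v * h y)"

definition lsc_fun :: "('a::topological_space \<Rightarrow> ereal) \<Rightarrow> bool" where
  "lsc_fun h \<longleftrightarrow> (\<forall>x. h x \<le> Liminf (at x) h)"

definition ind0 :: "'a::zero \<Rightarrow> ereal" where
  "ind0 x = (if x = 0 then 0 else \<infinity>)"

definition fenchel :: "('a::real_inner \<Rightarrow> ereal) \<Rightarrow> 'a \<Rightarrow> ereal" where
  "fenchel h s = (SUP x. ereal (s \<bullet> x) - h x)"

definition prox :: "real \<Rightarrow> ('a::real_normed_vector \<Rightarrow> ereal) \<Rightarrow> 'a \<Rightarrow> 'a" where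
  "prox \<alpha> h x =
     arg_min (\<lambda>y. h y + ereal (1 / (2 * \<alpha>) * (norm (x - y))\<^sup>2)) (\<lambda>_. True)"

text \<open>The smallest Lipschitz constant of \<open>g\<close> on \<open>U\<close>.\<close>

definition lip_const ::
  "('a::metric_space \<Rightarrow> 'b::metric_space) \<Rightarrow> 'a set \<Rightarrow> real" where
  "lip_const g U = Inf {L. L-lipschitz_on U g}"

definition saddle_points :: "('a \<Rightarrow> 'b \<Rightarrow> ereal) \<Rightarrow> ('a \<times> 'b) set" where
  "saddle_points \<Phi> =
     {(x, s). (\<forall>s'. \<Phi> x s' \<le> \<Phi> x s) \<and> (\<forall>x'. \<Phi> x s \<le> \<Phi> x' s)}"

text \<open>The restricted primal-dual gap; the maximum and the minimum over the given sets are
  taken as supremum and infimum in the extended reals.\<close>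

definition gap :: "('a \<Rightarrow> 'b \<Rightarrow> ereal) \<Rightarrow> 'a set \<Rightarrow> 'b set \<Rightarrow> 'a \<Rightarrow> 'b \<Rightarrow> ereal" where
  "gap \<Phi> B\<^sub>X B\<^sub>S x s = (SUP s'\<in>B\<^sub>S. \<Phi> x s') - (INF x'\<in>B\<^sub>X. \<Phi> x' s)"


subsection \<open>The network\<close>

definition connected_graph :: "('m \<times> 'm) set \<Rightarrow> bool" where
  "connected_graph E \<longleftrightarrow> sym E \<and> (\<forall>i j. (i, j) \<in> E\<^sup>*)"

definition nbhd :: "('m \<times> 'm) set \<Rightarrow> 'm \<Rightarrow> 'm set" where
  "nbhd E i = {i} \<union> {j. (i, j) \<in> E}"

definition doubly_stochastic :: "real^'m^'m::finite \<Rightarrow> bool" where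
  "doubly_stochastic A \<longleftrightarrow>
     (\<forall>i j. 0 \<le> A $ i $ j) \<and> (\<forall>i. (\<Sum>j\<in>UNIV. A $ i $ j) = 1) \<and> (\<forall>j. (\<Sum>i\<in>UNIV. A $ i $ j) = 1)"

definition gossip_matrix :: "('m \<times> 'm) set \<Rightarrow> real^'m^'m::finite \<Rightarrow> bool" where
  "gossip_matrix E A \<longleftrightarrow>
     transpose A = A \<and> doubly_stochastic A \<and>
     (\<forall>i. 0 < A $ i $ i) \<and>
     (\<forall>i j. (i, j) \<in> E \<longrightarrow> 0 < A $ i $ j) \<and>
     (\<forall>i j. i \<noteq> j \<longrightarrow> (i, j) \<notin> E \<longrightarrow> A $ i $ j = 0)"

definition psd :: "real^'m^'m::finite \<Rightarrow> bool" where
  "psd A \<longleftrightarrow> transpose A = A \<and> (\<forall>x. 0 \<le> x \<bullet> (A *v x))"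

definition psd_root :: "real^'m^'m::finite \<Rightarrow> real^'m^'m \<Rightarrow> bool" where
  "psd_root B A \<longleftrightarrow> psd B \<and> B ** B = A"

definition diag_mat :: "('m \<Rightarrow> real) \<Rightarrow> real^'m^'m::finite" where
  "diag_mat a = (\<chi> i j. if i = j then a i else 0)"


subsection \<open>The problem and its Lagrangian\<close>

definition F_sum :: "('m::finite \<Rightarrow> real^'d \<Rightarrow> real) \<Rightarrow> real^'d^'m \<Rightarrow> real" where
  "F_sum f X = (\<Sum>i\<in>UNIV. f i (X $ i))"

definition F_grad :: "('m::finite \<Rightarrow> real^'d \<Rightarrow> real) \<Rightarrow> real^'d^'m \<Rightarrow> real^'d^'m" where
  "F_grad f X = (\<chi> i. grad (f i) (X $ i))"

definition R_sum :: "('m::finite \<Rightarrow> real^'d \<Rightarrow> ereal) \<Rightarrow> real^'d^'m \<Rightarrow> ereal" where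
  "R_sum r X = (\<Sum>i\<in>UNIV. r i (X $ i))"

definition R_prox ::
  "('m::finite \<Rightarrow> real) \<Rightarrow> ('m \<Rightarrow> real^'d \<Rightarrow> ereal) \<Rightarrow> real^'d^'m \<Rightarrow> real^'d^'m" where
  "R_prox a r X = (\<chi> i. prox (a i) (r i) (X $ i))"

definition R_lift ::
  "('m::finite \<Rightarrow> real^'d \<Rightarrow> ereal) \<Rightarrow> (real^'d^'m) \<times> (real^'d^'m) \<Rightarrow> ereal" where
  "R_lift r Z = R_sum r (fst Z) + ind0 (snd Z)"

definition G_lift ::
  "real^'m^'m::finite \<Rightarrow> real^'m^'m \<Rightarrow> (real^'d^'m) \<times> (real^'d^'m) \<Rightarrow> ereal" where
  "G_lift Q M Z = ind0 (Q ** fst Z + M ** snd Z)"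

text \<open>In \<^typ>\<open>ereal\<close> we have \<open>\<infinity> - \<infinity> = \<infinity>\<close>, so the value is \<open>\<infinity>\<close> where both \<open>G_lift\<close> and the
  conjugate are infinite. For proper, convex, lower semicontinuous \<open>r i\<close> neither the set of
  saddle points nor the gap over sets that contain a saddle point depends on this choice.\<close>

definition lagrangian ::
  "('m::finite \<Rightarrow> real^'d \<Rightarrow> real) \<Rightarrow> ('m \<Rightarrow> real^'d \<Rightarrow> ereal) \<Rightarrow> real^'m^'m \<Rightarrow> real^'m^'m \<Rightarrow>
   (real^'d^'m) \<times> (real^'d^'m) \<Rightarrow> (real^'d^'m) \<times> (real^'d^'m) \<Rightarrow> ereal" where
  "lagrangian f r Q M Z T =
     ereal (F_sum f (fst Z)) + G_lift Q M Z + ereal (T \<bullet> Z) - fenchel (R_lift r) T"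


subsection \<open>The algorithm\<close>

text \<open>The test that agent \<open>i\<close> performs at the trial stepsize \<open>\<alpha>\<close>; \<open>x\<close>, \<open>xh\<close>, \<open>dh\<close> are the rows of
  \<open>X\<^sup>k\<close>, \<open>X\<^sup>k\<^sup>+\<^sup>1\<^sup>/\<^sup>2\<close>, \<open>D\<^sup>k\<^sup>+\<^sup>1\<^sup>/\<^sup>2\<close>.\<close>

definition descent_test ::
  "('a::real_inner \<Rightarrow> real) \<Rightarrow> real \<Rightarrow> 'a \<Rightarrow> 'a \<Rightarrow> 'a \<Rightarrow> real \<Rightarrow> bool" where
  "descent_test h \<delta> x xh dh \<alpha> \<longleftrightarrow>
     (let xp = xh - \<alpha> *\<^sub>R dh in
        h xp \<le> h x + grad h x \<bullet> (xp - x) + \<delta> / (2 * \<alpha>) * (norm (xp - x))\<^sup>2)"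

definition backtrack ::
  "('a::real_inner \<Rightarrow> real) \<Rightarrow> real \<Rightarrow> real \<Rightarrow> 'a \<Rightarrow> 'a \<Rightarrow> 'a \<Rightarrow> real \<Rightarrow> real" where
  "backtrack h \<eta> \<delta> x xh dh \<alpha>t =
     \<eta> ^ (LEAST j. descent_test h \<delta> x xh dh (\<eta> ^ j * \<alpha>t)) * \<alpha>t"

text \<open>Stepsizes are indexed with a shift by one: \<open>a 0 i\<close> is the initial stepsize \<open>\<alpha>\<^sub>i\<close> with
  superscript \<open>-1\<close>, and \<open>a (Suc k) i\<close> is the stepsize \<open>\<alpha>\<^sub>i\<^sup>k\<close> that is used in iteration \<open>k\<close> (after the
  min-consensus). The entry \<open>A 0\<close> is not constrained.\<close>

definition algorithm_run ::
  "('m::finite \<Rightarrow> real^'d \<Rightarrow> real) \<Rightarrow> ('m \<Rightarrow> real^'d \<Rightarrow> ereal) \<Rightarrow> ('m \<times> 'm) set \<Rightarrow> real^'m^'m \<Rightarrow>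
   real \<Rightarrow> real \<Rightarrow> (nat \<Rightarrow> real) \<Rightarrow> (nat \<Rightarrow> 'm \<Rightarrow> real) \<Rightarrow>
   (nat \<Rightarrow> real^'d^'m) \<Rightarrow> (nat \<Rightarrow> real^'d^'m) \<Rightarrow> (nat \<Rightarrow> real^'d^'m) \<Rightarrow> (nat \<Rightarrow> real^'d^'m) \<Rightarrow> bool"
where
  "algorithm_run f r E W \<eta> \<delta> \<mu> a X S D A \<longleftrightarrow>
     (\<forall>i. 0 < a 0 i) \<and> D 0 = 0 \<and>
     (\<forall>k.
       let Xh = W ** X k;
           Dh = W ** (F_grad f (X k) + S k + D k);
           b = (\<lambda>i. backtrack (f i) \<eta> \<delta> (X k $ i) (Xh $ i) (Dh $ i) (sqrt ((a k i)\<^sup>2 + \<mu> k)));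
           \<Lambda> = diag_mat (a (Suc k));
           \<Lambda>inv = diag_mat (\<lambda>i. 1 / a (Suc k) i);
           D\<Lambda> = (mat 1 - W) ** (\<Lambda>inv ** X k)
       in
         (\<forall>i. a (Suc k) i = Min (b ` nbhd E i)) \<and>
         A (Suc k) = Xh - \<Lambda> ** Dh \<and>
         X (Suc k) = R_prox (a (Suc k)) r (A (Suc k) + \<Lambda> ** S k) \<and>
         S (Suc k) = S k + \<Lambda>inv ** (A (Suc k) - X (Suc k)) \<and>
         D (Suc k) = Dh + D\<Lambda> - F_grad f (X k) - S k)"

definition a_min :: "(nat \<Rightarrow> 'm::finite \<Rightarrow> real) \<Rightarrow> nat \<Rightarrow> real" where
  "a_min a k = (MIN i. a k i)"

definition Y_run ::
  "('m::finite \<Rightarrow> real^'d \<Rightarrow> real) \<Rightarrow> real^'m^'m \<Rightarrow> (nat \<Rightarrow> 'm \<Rightarrow> real) \<Rightarrow>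
   (nat \<Rightarrow> real^'d^'m) \<Rightarrow> (nat \<Rightarrow> real^'d^'m) \<Rightarrow> (nat \<Rightarrow> real^'d^'m) \<Rightarrow> (nat \<Rightarrow> real^'d^'m) \<Rightarrow> bool"
where
  "Y_run f Q a X S D Y \<longleftrightarrow>
     Y 0 = 0 \<and>
     (\<forall>k. Y (Suc k) =
        Y k + Q ** (diag_mat (\<lambda>i. 1 / a (Suc k) i) ** X k - S k - D k - F_grad f (X k)))"

definition X_lift :: "(nat \<Rightarrow> real^'d^'m::finite) \<Rightarrow> nat \<Rightarrow> (real^'d^'m) \<times> (real^'d^'m)" where
  "X_lift X k = (X k, 0)"

definition S_lift ::
  "real^'m^'m::finite \<Rightarrow> (nat \<Rightarrow> real^'d^'m) \<Rightarrow> (nat \<Rightarrow> real^'d^'m) \<Rightarrow>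
   nat \<Rightarrow> (real^'d^'m) \<times> (real^'d^'m)" where
  "S_lift M S Y k = (S k, - (M ** Y k))"

text \<open>Meaningful for \<open>k \<ge> 1\<close> only; \<open>a k\<close> is the stepsize vector of iteration \<open>k - 1\<close>.\<close>

definition A_lift ::
  "real^'m^'m::finite \<Rightarrow> (nat \<Rightarrow> 'm \<Rightarrow> real) \<Rightarrow> (nat \<Rightarrow> real^'d^'m) \<Rightarrow> (nat \<Rightarrow> real^'d^'m) \<Rightarrow>
   nat \<Rightarrow> (real^'d^'m) \<times> (real^'d^'m)" where
  "A_lift M a A Y k = (A k, diag_mat (a k) ** (M ** (Y (k - 1) - Y k)))"

text \<open>Average of \<open>z\<close> over the indices \<open>K < t \<le> k\<close> with weights \<open>w t\<close>.\<close>

definition ergodic_avg :: "(nat \<Rightarrow> real) \<Rightarrow> nat \<Rightarrow> (nat \<Rightarrow> 'a::real_vector) \<Rightarrow> nat \<Rightarrow> 'a" where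
  "ergodic_avg w K z k =
     (1 / (\<Sum>t=Suc K..k. w t)) *\<^sub>R (\<Sum>t=Suc K..k. w t *\<^sub>R z t)"

definition L_local ::
  "('m::finite \<Rightarrow> real^'d \<Rightarrow> real) \<Rightarrow> (nat \<Rightarrow> real^'d^'m) \<Rightarrow> (nat \<Rightarrow> real^'d^'m) \<Rightarrow> nat \<Rightarrow> real" where
  "L_local f X A k =
     lip_const (F_grad f) (convex hull (\<Union>t<k. closed_segment (X t) (A (Suc t))))"

definition V_dist ::
  "(nat \<Rightarrow> 'm::finite \<Rightarrow> real) \<Rightarrow> (nat \<Rightarrow> 'a::real_normed_vector) \<Rightarrow>
   (nat \<Rightarrow> 'b::real_normed_vector) \<Rightarrow> nat \<Rightarrow> 'a \<Rightarrow> 'b \<Rightarrow> real" where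
  "V_dist a Z T k Zs Ts = (norm (Z k - Zs))\<^sup>2 + (a_min a k)\<^sup>2 * (norm (T k - Ts))\<^sup>2"

text \<open>The rate is an extended real because \<open>C\<close>, a sum of gaps, may be infinite, and because
  \<open>\<delta> / (2 * L)\<close> has to be read as \<open>\<infinity>\<close> when \<open>L = 0\<close>, which is what \<^typ>\<open>ereal\<close> division does.
  By the index shift \<open>a_min a t\<close> is the minimal stepsize with superscript \<open>t - 1\<close>.\<close>

definition C_const ::
  "(nat \<Rightarrow> 'm::finite \<Rightarrow> real) \<Rightarrow> ('a \<Rightarrow> 'b \<Rightarrow> ereal) \<Rightarrow> 'a set \<Rightarrow> 'b set \<Rightarrow>
   (nat \<Rightarrow> 'a) \<Rightarrow> (nat \<Rightarrow> 'b) \<Rightarrow> nat \<Rightarrow> ereal" where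
  "C_const a \<Phi> B\<^sub>X B\<^sub>S Z T K = 2 * (\<Sum>t=1..K. ereal (a_min a t) * gap \<Phi> B\<^sub>X B\<^sub>S (Z t) (T t))"

definition rate_bound :: "ereal \<Rightarrow> real \<Rightarrow> real \<Rightarrow> real \<Rightarrow> real \<Rightarrow> real \<Rightarrow> real \<Rightarrow> nat \<Rightarrow> ereal" where
  "rate_bound C aK alow V a0 \<delta> L n =
     ereal (1 / real n) *
     ((C + ereal ((1 + aK * sqrt (20 / alow\<^sup>2 + 3))\<^sup>2 * V)) /
      (2 * min (ereal a0) (ereal \<delta> / ereal (2 * L))))"

end

theory Submission
  imports Defs
begin

text \<open>
  Write \<open>p\<^sub>i\<close> for the squared stepsize of agent \<open>i\<close> minus the sum of the \<open>\<mu>\<close> added so far. It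
  decreases and is bounded below, and a genuine backtracking step lowers it by a fixed amount. So
  backtracking stops, and then the min-consensus spreads the smallest \<open>p\<^sub>i\<close> over the connected graph:
  from some iteration on all agents share one nondecreasing stepsize \<open>w\<close>, and the lifted iteration is a
  three-operator splitting \<open>A' = P\<^sub>V (x - w (\<nabla>F x + s))\<close>, \<open>s' = s + (A' - x') / w \<in> \<partial>R x'\<close>, where
  \<open>V = ker [Q M]\<close>. For \<open>z \<in> V\<close> and \<open>t \<in> dom R\<^sup>*\<close> it satisfies
  \<open>2 w (L(A', t) - L(z, s')) \<le> |x - z|\<^sup>2 - |x' - z|\<^sup>2 + w\<^sup>2 (|s - t|\<^sup>2 - |s' - t|\<^sup>2) - (1 - \<delta>) |x - A'|\<^sup>2\<close>.
  At a saddle point this makes \<open>|x - z|\<^sup>2 / w\<^sup>2 + |s - t|\<^sup>2\<close> nonincreasing, and the iterates converge to a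
  saddle point because cluster points satisfy the optimality conditions.

  The local Lipschitz constant in the rate only sees the accepted steps, so it does not control the
  stepsizes when a rejected trial point leaves the hull of the iterates. The rate is obtained from the
  constant \<open>C\<close> instead. Take for the comparison sets the given saddle point together with a ball of
  radius \<open>\<rho>\<close> around the limit. If some \<open>(A\<^sup>t, S\<^sup>t)\<close> is not a saddle point, its gap is at least linear in \<open>\<rho>\<close>,
  hence so is \<open>C\<close>, while \<open>\<theta>\<^sup>k\<close> times the ergodic gap is \<open>O(\<rho>\<^sup>2)\<close> once \<open>K'\<close> is large; a small \<open>\<rho>\<close> wins.
  If all \<open>(A\<^sup>t, S\<^sup>t)\<close> are saddle points, the averages are saddle points and their gap vanishes.
\<close>

subsection \<open>Proximal steps\<close>

text \<open>Finiteness of \<open>h x\<close> is part of the notion: at a point with value -infinity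
  the inequality would hold for every \<open>s\<close>.\<close>

definition subgrad :: "('a::real_inner \<Rightarrow> ereal) \<Rightarrow> 'a \<Rightarrow> 'a \<Rightarrow> bool" where
  "subgrad h x s \<longleftrightarrow> \<bar>h x\<bar> \<noteq> \<infinity> \<and> (\<forall>y. h x + ereal (s \<bullet> (y - x)) \<le> h y)"

text \<open>\<open>lsc_fun\<close> speaks of the punctured neighbourhood filter. Adding the point
  itself gives a condition on \<open>nhds\<close>, which composes with convergent sequences and
  yields open superlevel sets.\<close>

lemma lsc_fun_eventually:
  assumes "lsc_fun h" "c < h x"
  shows "\<forall>\<^sub>F y in nhds x. c < h y"
proof -
  have "c < Liminf (at x) h"
    using assms by (auto simp: lsc_fun_def intro: less_le_trans)
  then have "\<forall>\<^sub>F y in at x. c < h y"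
    by (rule less_LiminfD)
  then show ?thesis
    using assms(2) by (auto simp: eventually_at_filter elim: eventually_mono)
qed

lemma open_superlevel:
  fixes h :: "'a::topological_space \<Rightarrow> ereal"
  assumes "\<And>c x. c < h x \<Longrightarrow> \<forall>\<^sub>F y in nhds x. c < h y"
  shows "open {x. c < h x}"
proof (subst open_subopen, safe)
  fix x assume "c < h x"
  then obtain S where "open S" "x \<in> S" "\<forall>y\<in>S. c < h y"
    using assms by (metis eventually_nhds)
  then show "\<exists>T. open T \<and> x \<in> T \<and> T \<subseteq> {x. c < h x}"
    by blast
qed

text \<open>Without a minimizer the open sets \<open>{x. h y < h x}\<close> with \<open>y\<close> in
  \<open>K\<close> cover \<open>K\<close>. In a finite subcover the centre of smallest value lies in
  none of the chosen sets.\<close>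

lemma lsc_attains_min:
  fixes h :: "'a::topological_space \<Rightarrow> ereal"
  assumes "\<And>c x. c < h x \<Longrightarrow> \<forall>\<^sub>F y in nhds x. c < h y"
    and "compact K" "K \<noteq> {}"
  shows "\<exists>x\<in>K. \<forall>y\<in>K. h x \<le> h y"
proof (rule ccontr)
  assume "\<not> ?thesis"
  then have cov: "K \<subseteq> (\<Union>y\<in>K. {x. h y < h x})"
    by (force simp: not_le)
  obtain C where C: "C \<subseteq> K" "finite C" "K \<subseteq> (\<Union>y\<in>C. {x. h y < h x})"
    using compactE_image[OF \<open>compact K\<close> _ cov] open_superlevel[of h, OF assms(1)] by metis
  have "C \<noteq> {}" using C \<open>K \<noteq> {}\<close> by auto
  then obtain y where y: "y \<in> C" "\<forall>z\<in>C. h y \<le> h z"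
    using C(2) by (metis (no_types, lifting) arg_min_if_finite(1,2) linorder_not_less)
  then show False
    using C by (force simp: not_le[symmetric])
qed

text \<open>A cone-shaped minorant: \<open>b\<close> is the minimum of \<open>h\<close> on the unit
  ball around \<open>y0\<close>, and convexity along the segment from \<open>y0\<close> through the
  unit sphere to a far \<open>y\<close> limits the descent to the slope
  \<open>h0 - b\<close>.\<close>

lemma convex_lsc_linear_lower_bound:
  fixes h :: "'a::euclidean_space \<Rightarrow> ereal"
  assumes "proper_fun h" "convex_fun h" "lsc_fun h" "h y0 \<noteq> \<infinity>"
  shows "\<exists>b k. 0 \<le> k \<and> (\<forall>y. ereal (b - k * norm (y - y0)) \<le> h y)"
proof -
  have ninf: "h y \<noteq> -\<infinity>" for y
    using assms(1) by (auto simp: proper_fun_def)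
  obtain z0 where z0: "z0 \<in> cball y0 1" "\<And>y. y \<in> cball y0 1 \<Longrightarrow> h z0 \<le> h y"
    using lsc_attains_min[OF lsc_fun_eventually[OF assms(3)], of "cball y0 1"] by auto
  have "h z0 \<le> h y0" using z0(2)[of y0] by simp
  then obtain b h0 where b: "h z0 = ereal b" and h0: "h y0 = ereal h0" and "b \<le> h0"
    using ninf[of z0] ninf[of y0] assms(4) by (cases "h z0"; cases "h y0") auto
  have "ereal (b - (h0 - b) * norm (y - y0)) \<le> h y" for y
  proof (cases "norm (y - y0) \<le> 1")
    case True
    then have "ereal b \<le> h y"
      using z0(2)[of y] b by (simp add: dist_norm norm_minus_commute)
    moreover have "b - (h0 - b) * norm (y - y0) \<le> b"
      using \<open>b \<le> h0\<close> by simp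
    ultimately show ?thesis by (meson ereal_less_eq(3) order_trans)
  next
    case False
    define \<rho> where "\<rho> = norm (y - y0)"
    have \<rho>: "\<rho> > 1" using False by (simp add: \<rho>_def)
    define z where "z = (1 - 1 / \<rho>) *\<^sub>R y0 + (1 / \<rho>) *\<^sub>R y"
    have "z - y0 = (1 / \<rho>) *\<^sub>R (y - y0)"
      by (simp add: z_def algebra_simps)
    moreover have "norm (y - y0) \<noteq> 0" using False by auto
    ultimately have "norm (z - y0) = 1" by (simp add: \<rho>_def)
    then have "ereal b \<le> h z"
      using z0(2)[of z] b by (simp add: dist_norm norm_minus_commute)
    also have "h z \<le> ereal (1 - 1 / \<rho>) * h y0 + ereal (1 / \<rho>) * h y"
      using assms(2) \<rho> unfolding convex_fun_def z_def by simp
    finally have *: "ereal b \<le> ereal ((1 - 1 / \<rho>) * h0) + ereal (1 / \<rho>) * h y"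
      by (simp add: h0)
    show ?thesis
    proof (cases "h y")
      case (real v)
      then have "b \<le> (1 - 1 / \<rho>) * h0 + (1 / \<rho>) * v" using * by simp
      then have "\<rho> * b \<le> \<rho> * ((1 - 1 / \<rho>) * h0 + (1 / \<rho>) * v)"
        using \<rho> by (intro mult_left_mono) auto
      also have "\<dots> = \<rho> * h0 - h0 + v" using \<rho> by (simp add: field_simps)
      finally have "b - (h0 - b) * \<rho> \<le> v"
        using \<open>b \<le> h0\<close> by (simp add: algebra_simps)
      then show ?thesis by (simp add: real \<rho>_def)
    qed (use ninf in auto)
  qed
  then show ?thesis using \<open>b \<le> h0\<close> by (intro exI[of _ b] exI[of _ "h0 - b"]) auto
qed

text \<open>\<open>prox\<close> is a choice of minimizer, so it has this property only once a
  minimizer exists. The quadratic term beats the cone minorant of \<open>h\<close>, which confines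
  the search to a closed ball, where lower semicontinuity gives a minimum.\<close>

lemma prox_is_minimizer:
  fixes h :: "'a::euclidean_space \<Rightarrow> ereal"
  assumes "proper_fun h" "convex_fun h" "lsc_fun h" "0 < \<alpha>"
  shows "h (prox \<alpha> h x) + ereal (1 / (2 * \<alpha>) * (norm (x - prox \<alpha> h x))\<^sup>2)
       \<le> h y + ereal (1 / (2 * \<alpha>) * (norm (x - y))\<^sup>2)"
proof -
  define q where "q y = 1 / (2 * \<alpha>) * (norm (x - y))\<^sup>2" for y
  define \<phi> where "\<phi> y = h y + ereal (q y)" for y
  have ninf: "h y \<noteq> -\<infinity>" for y
    using assms(1) by (auto simp: proper_fun_def)
  obtain y0 where y0: "h y0 \<noteq> \<infinity>"
    using assms(1) by (auto simp: proper_fun_def)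
  obtain h0 where h0: "h y0 = ereal h0"
    using y0 ninf[of y0] by (cases "h y0") auto
  obtain b k where k: "0 \<le> k" and lb: "\<And>y. ereal (b - k * norm (y - y0)) \<le> h y"
    using convex_lsc_linear_lower_bound[OF assms(1-3) y0] by auto
  have ev: "\<forall>\<^sub>F y' in nhds y. c < \<phi> y'" if "c < \<phi> y" for c y
  proof (cases c)
    case (real c0)
    have "ereal (c0 - q y) < h y"
      using that real by (cases "h y") (auto simp: \<phi>_def)
    then obtain c1 where c1: "c0 - q y < c1" "ereal c1 < h y"
      by (metis ereal_dense2 less_ereal.simps(1))
    have "(q \<longlongrightarrow> q y) (nhds y)"
      unfolding q_def by (intro tendsto_intros filterlim_ident)
    then have "\<forall>\<^sub>F y' in nhds y. c0 - c1 < q y'"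
      using c1 by (auto intro: order_tendstoD)
    with lsc_fun_eventually[OF assms(3) c1(2)] show ?thesis
    proof eventually_elim
      case (elim y')
      then show ?case using real by (cases "h y'") (auto simp: \<phi>_def)
    qed
  next
    case MInf
    then show ?thesis using ninf by (simp add: \<phi>_def)
  qed (use that in auto)
  define n where "n = norm (x - y0)"
  define P where "P = h0 + q y0"
  \<comment> \<open>\<open>Z\<close> and the radius are made so that outside the ball the quadratic
    term is at least \<open>t * (k + Z)\<close> with \<open>t \<ge> 1\<close>: this outweighs the
    linear loss \<open>k * t\<close> and leaves \<open>Z\<close>, which lifts the value above
    \<open>P\<close>.\<close>
  define Z where "Z = \<bar>P\<bar> + \<bar>b\<bar> + k * n + 1"
  define \<rho> where "\<rho> = n + max 1 (2 * \<alpha> * (k + Z))"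
  have "0 \<le> n" by (simp add: n_def)
  then have \<rho>0: "0 \<le> \<rho>" by (simp add: \<rho>_def)
  have far: "ereal P < \<phi> y" if "\<rho> < norm (y - y0)" for y
  proof -
    define t where "t = norm (y - y0) - n"
    have t: "1 \<le> t" "2 * \<alpha> * (k + Z) \<le> t" using that by (auto simp: t_def \<rho>_def)
    have "norm (y - y0) \<le> norm (x - y) + norm (x - y0)"
      using norm_triangle_ineq[of "y - x" "x - y0"] by (simp add: norm_minus_commute)
    then have "t \<le> norm (x - y)" by (simp add: t_def n_def)
    then have "t\<^sup>2 \<le> (norm (x - y))\<^sup>2" using t by (intro power_mono) auto
    then have "t\<^sup>2 / (2 * \<alpha>) \<le> q y" using \<open>0 < \<alpha>\<close> by (simp add: q_def divide_simps)
    moreover have "t * (2 * \<alpha> * (k + Z)) \<le> t * t" using t by (intro mult_left_mono) auto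
    then have "t * (k + Z) \<le> t\<^sup>2 / (2 * \<alpha>)"
      using \<open>0 < \<alpha>\<close> by (simp add: field_simps power2_eq_square)
    moreover have "Z \<ge> 0" using \<open>0 \<le> n\<close> k by (simp add: Z_def)
    then have "1 * Z \<le> t * Z" using t by (intro mult_right_mono) auto
    moreover have "k * norm (y - y0) = k * t + k * n" by (simp add: t_def algebra_simps)
    ultimately have "P < (b - k * norm (y - y0)) + q y"
      by (simp add: Z_def algebra_simps)
    also have "ereal \<dots> \<le> \<phi> y"
      using lb[of y] by (cases "h y") (auto simp: \<phi>_def)
    finally show ?thesis by simp
  qed
  have "cball y0 \<rho> \<noteq> {}" using \<rho>0 by simp
  from lsc_attains_min[OF ev compact_cball this]
  obtain p where p: "\<And>y. y \<in> cball y0 \<rho> \<Longrightarrow> \<phi> p \<le> \<phi> y"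
    by blast
  have "\<phi> y0 = ereal P" by (simp add: \<phi>_def P_def h0)
  then have "\<phi> p \<le> ereal P" using p[of y0] \<rho>0 by simp
  have "\<phi> p \<le> \<phi> y" for y
  proof (cases "y \<in> cball y0 \<rho>")
    case False
    then show ?thesis
      using far[of y] \<open>\<phi> p \<le> ereal P\<close> by (simp add: dist_norm norm_minus_commute)
  qed (rule p)
  then have "is_arg_min \<phi> (\<lambda>_. True) p"
    by (auto simp: is_arg_min_def not_less)
  then have "is_arg_min \<phi> (\<lambda>_. True) (prox \<alpha> h x)"
    unfolding prox_def arg_min_def \<phi>_def q_def by (rule someI)
  then show ?thesis
    by (auto simp: is_arg_min_def not_less \<phi>_def q_def)
qed

lemma real_le_of_small_perturbation:
  fixes a b c :: real
  assumes "\<And>t. 0 < t \<Longrightarrow> t < 1 \<Longrightarrow> a \<le> b + t * c"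
  shows "a \<le> b"
proof -
  have "((\<lambda>t. b + t * c) \<longlongrightarrow> b + 0 * c) (at_right 0)"
    by (intro tendsto_intros)
  moreover have "\<forall>\<^sub>F t in at_right 0. a \<le> b + t * c"
    using assms eventually_at_right[of "0::real" 1] by (auto intro!: exI[of _ "1::real"])
  ultimately have "a \<le> b + 0 * c"
    by (rule tendsto_lowerbound) simp
  then show ?thesis by simp
qed

text \<open>Compare the minimizer \<open>p\<close> with \<open>(1 - t) p + t y\<close>, use
  convexity, divide by \<open>t\<close> and let \<open>t\<close> tend to 0; the quadratic remainder
  is of order \<open>t\<close>.\<close>

lemma prox_subgrad:
  fixes h :: "'a::euclidean_space \<Rightarrow> ereal"
  assumes "proper_fun h" "convex_fun h" "lsc_fun h" "0 < \<alpha>"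
  shows "subgrad h (prox \<alpha> h x) ((1 / \<alpha>) *\<^sub>R (x - prox \<alpha> h x))"
proof -
  define p where "p = prox \<alpha> h x"
  have ninf: "h y \<noteq> -\<infinity>" for y
    using assms(1) by (auto simp: proper_fun_def)
  note min = prox_is_minimizer[OF assms, of x, folded p_def]
  obtain y0 where y0: "h y0 \<noteq> \<infinity>"
    using assms(1) by (auto simp: proper_fun_def)
  have "h p \<noteq> \<infinity>" using min[of y0] y0 by auto
  then obtain hp where hp: "h p = ereal hp" using ninf[of p] by (cases "h p") auto
  have "h p + ereal (((1 / \<alpha>) *\<^sub>R (x - p)) \<bullet> (y - p)) \<le> h y" for y
  proof (cases "h y")
    case (real v)
    have "hp + ((1 / \<alpha>) *\<^sub>R (x - p)) \<bullet> (y - p) \<le> v + t * (1 / (2 * \<alpha>) * (norm (y - p))\<^sup>2)"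
      if t: "0 < t" "t < 1" for t
    proof -
      define z where "z = (1 - t) *\<^sub>R p + t *\<^sub>R y"
      have "h z \<le> ereal (1 - t) * h p + ereal t * h y"
        using assms(2) t unfolding convex_fun_def z_def by simp
      then have "h z \<le> ereal ((1 - t) * hp + t * v)" by (simp add: hp real)
      then have "h z + ereal (1 / (2 * \<alpha>) * (norm (x - z))\<^sup>2)
          \<le> ereal ((1 - t) * hp + t * v + 1 / (2 * \<alpha>) * (norm (x - z))\<^sup>2)"
        by (metis add_right_mono plus_ereal.simps(1))
      with min[of z] have "hp + 1 / (2 * \<alpha>) * (norm (x - p))\<^sup>2
          \<le> (1 - t) * hp + t * v + 1 / (2 * \<alpha>) * (norm (x - z))\<^sup>2"
        by (simp add: hp) (meson ereal_less_eq(3) order_trans)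
      moreover have xz: "x - z = (x - p) - t *\<^sub>R (y - p)"
        by (simp add: z_def algebra_simps)
      have "(norm (x - z))\<^sup>2 = (norm (x - p))\<^sup>2 - 2 * t * ((x - p) \<bullet> (y - p)) + t\<^sup>2 * (norm (y - p))\<^sup>2"
        by (simp only: power2_norm_eq_inner xz)
          (simp add: inner_diff_left inner_diff_right inner_commute power2_eq_square algebra_simps)
      ultimately have "t * hp + 1 / (2 * \<alpha>) * (2 * t * ((x - p) \<bullet> (y - p)))
          \<le> t * v + 1 / (2 * \<alpha>) * (t\<^sup>2 * (norm (y - p))\<^sup>2)"
        by (simp add: ring_distribs)
      then have "t * (hp + ((1 / \<alpha>) *\<^sub>R (x - p)) \<bullet> (y - p)) \<le> t * (v + t * (1 / (2 * \<alpha>) * (norm (y - p))\<^sup>2))"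
        by (simp add: ring_distribs power2_eq_square mult_ac)
      then show ?thesis using t by simp
    qed
    then have "hp + ((1 / \<alpha>) *\<^sub>R (x - p)) \<bullet> (y - p) \<le> v"
      by (rule real_le_of_small_perturbation)
    then show ?thesis by (simp add: hp real)
  qed (use ninf in auto)
  then show ?thesis by (simp add: subgrad_def p_def[symmetric] hp)
qed

text \<open>In the subgradient inequality the inner products converge, while lower semicontinuity
  bounds \<open>h x\<close> by the limit of the right-hand sides. Properness supplies a finite value
  of \<open>h\<close>, hence finiteness of \<open>h x\<close>.\<close>

lemma subgrad_closed:
  fixes h :: "'a::real_inner \<Rightarrow> ereal"
  assumes "proper_fun h" "lsc_fun h"
    and sub: "\<And>n. subgrad h (xs n) (ss n)"
    and lim: "xs \<longlonglongrightarrow> x" "ss \<longlonglongrightarrow> s"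
  shows "subgrad h x s"
proof -
  have ninf: "h y \<noteq> -\<infinity>" for y
    using assms(1) by (auto simp: proper_fun_def)
  have le: "h x \<le> ereal (v - s \<bullet> (y - x))" if v: "h y = ereal v" for y v
  proof (rule ccontr)
    assume "\<not> ?thesis"
    then have "ereal (v - s \<bullet> (y - x)) < h x" by simp
    then obtain c where c: "v - s \<bullet> (y - x) < c" "ereal c < h x"
      by (metis ereal_dense2 less_ereal.simps(1))
    have "\<forall>\<^sub>F n in sequentially. ereal c < h (xs n)"
      using lsc_fun_eventually[OF assms(2) c(2)] lim(1) by (rule eventually_compose_filterlim)
    moreover have "(\<lambda>n. v - ss n \<bullet> (y - xs n)) \<longlonglongrightarrow> v - s \<bullet> (y - x)"
      by (intro tendsto_intros lim)
    then have "\<forall>\<^sub>F n in sequentially. v - ss n \<bullet> (y - xs n) < c"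
      using c(1) by (rule order_tendstoD)
    ultimately have "\<forall>\<^sub>F n in sequentially. False"
    proof eventually_elim
      case (elim n)
      have "h (xs n) + ereal (ss n \<bullet> (y - xs n)) \<le> ereal v"
        using sub[of n] v by (metis subgrad_def)
      then show ?case using elim by (cases "h (xs n)") auto
    qed
    then show False by simp
  qed
  obtain y0 v0 where "h y0 = ereal v0"
    using assms(1) ninf by (metis proper_fun_def ereal_cases)
  from le[OF this] ninf[of x] obtain hx where hx: "h x = ereal hx"
    by (cases "h x") auto
  have "h x + ereal (s \<bullet> (y - x)) \<le> h y" for y
    using le[of y] ninf[of y] hx by (cases "h y") auto
  then show ?thesis by (simp add: subgrad_def hx)
qed

subsection \<open>Gradients of convex functions\<close>

text \<open>\<open>grad\<close> is a definite description, so both existence and uniqueness are due.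
  The Riesz vector of the derivative is assembled from the basis.\<close>

lemma differentiable_has_gradient:
  fixes f :: "'a::euclidean_space \<Rightarrow> real"
  assumes "f differentiable (at x)"
  shows "GDERIV f x :> grad f x"
proof -
  obtain f' where f': "(f has_derivative f') (at x)"
    using assms by (auto simp: differentiable_def)
  then have lin: "linear f'" by (rule has_derivative_linear)
  define g where "g = (\<Sum>b\<in>Basis. f' b *\<^sub>R b)"
  have "f' h = h \<bullet> g" for h
  proof -
    have "f' h = f' (\<Sum>b\<in>Basis. (h \<bullet> b) *\<^sub>R b)" by (simp add: euclidean_representation)
    also have "\<dots> = h \<bullet> g"
      by (simp add: linear_sum[OF lin] linear_cmul[OF lin] g_def inner_sum_right mult.commute)
    finally show ?thesis .
  qed
  then have "f' = (\<lambda>h. h \<bullet> g)" by (rule ext)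
  then have g: "GDERIV f x :> g" using f' by (simp add: gderiv_def)
  have "g' = g" if "GDERIV f x :> g'" for g'
  proof -
    have "(\<lambda>h. h \<bullet> g') = (\<lambda>h. h \<bullet> g)"
      using that g unfolding gderiv_def by (rule has_derivative_unique)
    then have "h \<bullet> g' = h \<bullet> g" for h by metis
    then show ?thesis by (metis vector_eq_rdot inner_commute)
  qed
  then show ?thesis
    unfolding grad_def using g by (metis theI)
qed

text \<open>By convexity the difference quotients along the segment to \<open>z\<close> never exceed
  \<open>f z - f y\<close>; their limit from the right is the directional derivative.\<close>

lemma convex_tangent:
  fixes f :: "'a::euclidean_space \<Rightarrow> real"
  assumes "convex_on UNIV f" "f differentiable (at y)"
  shows "f y + grad f y \<bullet> (z - y) \<le> f z"
proof -
  have "(f has_derivative (\<lambda>h. h \<bullet> grad f y)) (at y)"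
    using differentiable_has_gradient[OF assms(2)] by (simp add: gderiv_def)
  then have "((\<lambda>t. f (y + t *\<^sub>R (z - y))) has_derivative (\<lambda>t. (t *\<^sub>R (z - y)) \<bullet> grad f y)) (at (0::real))"
    by (intro has_derivative_compose[where f = "\<lambda>t. y + t *\<^sub>R (z - y)" and g = f, simplified])
      (auto intro!: derivative_eq_intros)
  then have "((\<lambda>t. f (y + t *\<^sub>R (z - y))) has_field_derivative ((z - y) \<bullet> grad f y)) (at 0)"
    by (simp add: has_field_derivative_def mult.commute mult_commute_abs)
  then have "(\<lambda>t. (f (y + t *\<^sub>R (z - y)) - f y) / t) \<midarrow>0\<rightarrow> (z - y) \<bullet> grad f y"
    by (simp add: has_field_derivative_iff)
  then have lim: "((\<lambda>t. (f (y + t *\<^sub>R (z - y)) - f y) / t) \<longlongrightarrow> (z - y) \<bullet> grad f y) (at_right 0)"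
    by (rule filterlim_mono) (auto simp: at_within_le_at)
  have "(f (y + t *\<^sub>R (z - y)) - f y) / t \<le> f z - f y" if "0 < t" "t < 1" for t
  proof -
    have "f ((1 - t) *\<^sub>R y + t *\<^sub>R z) \<le> (1 - t) * f y + t * f z"
      using assms(1) that by (intro convex_onD) auto
    moreover have "y + t *\<^sub>R (z - y) = (1 - t) *\<^sub>R y + t *\<^sub>R z" by (simp add: algebra_simps)
    ultimately have "f (y + t *\<^sub>R (z - y)) - f y \<le> t * (f z - f y)" by (simp add: algebra_simps)
    then show ?thesis using that by (simp add: pos_divide_le_eq mult.commute)
  qed
  then have "\<forall>\<^sub>F t in at_right 0. (f (y + t *\<^sub>R (z - y)) - f y) / t \<le> f z - f y"
    using eventually_at_right[of "0::real" 1] by (auto intro!: exI[of _ "1::real"])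
  then have "(z - y) \<bullet> grad f y \<le> f z - f y"
    using lim by (intro tendsto_upperbound[OF lim]) auto
  then show ?thesis by (simp add: inner_commute)
qed

lemma locally_smooth_isCont_grad:
  assumes "locally_smooth f"
  shows "isCont (grad f) x"
proof -
  obtain e L where "0 < e" "L-lipschitz_on (cball x e) (grad f)"
    using assms unfolding locally_smooth_def by blast
  then have "continuous_on (ball x e) (grad f)"
    by (meson ball_subset_cball continuous_on_subset lipschitz_on_continuous_on)
  then show ?thesis using \<open>0 < e\<close>
    by (simp add: continuous_on_eq_continuous_at)
qed

section \<open>Termination of backtracking\<close>

text \<open>There are two different reasons. If \<open>xh = x\<close>, the trial points tend to
  \<open>x\<close>, and the local Lipschitz constant satisfies \<open>2 * L * t < \<delta>\<close>
  for small \<open>t\<close>. Otherwise they stay away from \<open>x\<close>, and the term with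
  \<open>\<delta> / (2 * t)\<close> blows up.\<close>

lemma descent_test_small_step:
  fixes h :: "'a::euclidean_space \<Rightarrow> real"
  assumes "convex_on UNIV h" "locally_smooth h" "0 < \<delta>"
  shows "\<forall>\<^sub>F t in at_right 0. descent_test h \<delta> x xh dh t"
proof (cases "xh = x")
  case True
  have diff: "h differentiable (at y)" for y
    using assms(2) by (simp add: locally_smooth_def)
  obtain e L where e: "0 < e" "L-lipschitz_on (cball x e) (grad h)"
    using assms(2) unfolding locally_smooth_def by blast
  have "((\<lambda>t. norm (t *\<^sub>R dh)) \<longlongrightarrow> norm (0 *\<^sub>R dh)) (at_right 0)"
    by (intro tendsto_intros)
  then have "\<forall>\<^sub>F t in at_right 0. norm (t *\<^sub>R dh) < e"
    using e(1) by (intro order_tendstoD) auto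
  moreover have "((\<lambda>t. 2 * L * t) \<longlongrightarrow> 2 * L * 0) (at_right 0)"
    by (intro tendsto_intros)
  then have "\<forall>\<^sub>F t in at_right 0. 2 * L * t < \<delta>"
    using assms(3) by (intro order_tendstoD) auto
  moreover have "\<forall>\<^sub>F t in at_right (0::real). 0 < t"
    by (rule eventually_at_right_less)
  ultimately show ?thesis
  proof eventually_elim
    case (elim t)
    define y where "y = x - t *\<^sub>R dh"
    have "dist x y < e" using elim by (simp add: y_def dist_norm)
    then have "dist (grad h y) (grad h x) \<le> L * dist y x"
      using e by (intro lipschitz_onD[OF e(2)]) (auto simp: dist_commute)
    then have "(grad h y - grad h x) \<bullet> (y - x) \<le> L * norm (y - x) * norm (y - x)"
      by (smt (verit) dist_norm mult_right_mono norm_cauchy_schwarz norm_ge_zero)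
    \<comment> \<open>The tangent at \<open>y\<close> replaces an integral along the segment: the
      resulting constant is \<open>L\<close> rather than \<open>L / 2\<close>, which small
      \<open>t\<close> absorbs.\<close>
    moreover have "h y + grad h y \<bullet> (x - y) \<le> h x"
      by (rule convex_tangent[OF assms(1) diff])
    ultimately have "h y \<le> h x + grad h x \<bullet> (y - x) + L * (norm (y - x))\<^sup>2"
      by (simp add: algebra_simps inner_diff_left inner_diff_right power2_eq_square)
    also have "L * (norm (y - x))\<^sup>2 \<le> \<delta> / (2 * t) * (norm (y - x))\<^sup>2"
      using elim by (intro mult_right_mono) (auto simp: field_simps)
    finally show ?case using True by (simp add: descent_test_def y_def Let_def)
  qed
next
  case False
  define q where "q t = 2 * t * (h (xh - t *\<^sub>R dh) - h x - grad h x \<bullet> (xh - t *\<^sub>R dh - x))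
      - \<delta> * (norm (xh - t *\<^sub>R dh - x))\<^sup>2" for t
  have cont: "isCont h y" for y
    using assms(2) by (auto simp: locally_smooth_def differentiable_imp_continuous_within)
  have "((\<lambda>t. xh - t *\<^sub>R dh) \<longlongrightarrow> xh - 0 *\<^sub>R dh) (at_right 0)"
    by (intro tendsto_intros)
  then have "((\<lambda>t. h (xh - t *\<^sub>R dh)) \<longlongrightarrow> h xh) (at_right 0)"
    by (intro isCont_tendsto_compose[OF cont]) simp
  then have "(q \<longlongrightarrow> 2 * 0 * (h xh - h x - grad h x \<bullet> (xh - 0 *\<^sub>R dh - x))
      - \<delta> * (norm (xh - 0 *\<^sub>R dh - x))\<^sup>2) (at_right 0)"
    unfolding q_def by (intro tendsto_intros)
  then have "\<forall>\<^sub>F t in at_right 0. q t < 0"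
    using False assms(3) by (intro order_tendstoD) auto
  moreover have "\<forall>\<^sub>F t in at_right (0::real). 0 < t"
    by (rule eventually_at_right_less)
  ultimately show ?thesis
    by eventually_elim (simp add: descent_test_def Let_def q_def field_simps)
qed

lemma exists_backtracking_step:
  fixes h :: "'a::euclidean_space \<Rightarrow> real"
  assumes "convex_on UNIV h" "locally_smooth h" "0 < \<delta>" "0 < \<eta>" "\<eta> < 1" "0 < \<tau>"
  shows "\<exists>j. descent_test h \<delta> x xh dh (\<eta> ^ j * \<tau>)"
proof -
  have "(\<lambda>j. \<eta> ^ j * \<tau>) \<longlonglongrightarrow> 0 * \<tau>"
    using assms by (intro tendsto_intros LIMSEQ_realpow_zero) auto
  then have "filterlim (\<lambda>j. \<eta> ^ j * \<tau>) (at_right 0) sequentially"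
    using assms by (auto simp: filterlim_at)
  from eventually_compose_filterlim[OF descent_test_small_step[OF assms(1-3)] this]
  show ?thesis by (meson eventually_happens' sequentially_bot)
qed

subsection \<open>The Lagrangian of a problem constrained to a subspace\<close>

text \<open>Later \<open>V\<close> is the kernel of the block matrix \<open>[Q M]\<close> and
  \<open>R\<close> is \<open>R_lift r\<close>. The assumption \<open>subgrad_exists\<close> makes
  the conjugate of \<open>R\<close> proper: never -infinity, and finite somewhere.\<close>

locale constrained_lagrangian =
  fixes F :: "'a::euclidean_space \<Rightarrow> real" and g :: "'a \<Rightarrow> 'a"
    and V :: "'a set" and R :: "'a \<Rightarrow> ereal"
  assumes tangent: "F y + g y \<bullet> (z - y) \<le> F z"
    and V_subspace: "subspace V"
    and R_ninf: "R z \<noteq> -\<infinity>"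
    and subgrad_exists: "\<exists>z T. subgrad R z T"
begin

definition Lag :: "'a \<Rightarrow> 'a \<Rightarrow> ereal" where
  "Lag Z T = ereal (F Z) + (if Z \<in> V then 0 else \<infinity>) + ereal (T \<bullet> Z) - fenchel R T"

definition conj_dom :: "'a set" where
  "conj_dom = {T. fenchel R T \<noteq> \<infinity>}"

definition conj_val :: "'a \<Rightarrow> real" where
  "conj_val T = real_of_ereal (fenchel R T)"

text \<open>The finite part of \<open>Lag\<close>. The two agree for \<open>Z\<close> in
  \<open>V\<close> and \<open>T\<close> in \<open>conj_dom\<close>; \<open>lag\<close> does not see
  the constraint, and outside \<open>conj_dom\<close> the value of \<open>conj_val\<close> is a mere
  default.\<close>

definition lag :: "'a \<Rightarrow> 'a \<Rightarrow> real" where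
  "lag Z T = F Z + T \<bullet> Z - conj_val T"

lemma fenchel_ninf: "fenchel R T \<noteq> -\<infinity>"
proof -
  obtain z \<rho> where \<rho>: "R z = ereal \<rho>" using subgrad_exists by (auto simp: subgrad_def)
  have "ereal (T \<bullet> z) - R z \<le> fenchel R T"
    unfolding fenchel_def by (rule SUP_upper) simp
  then show ?thesis by (auto simp: \<rho>)
qed

lemma fenchel_eq: "T \<in> conj_dom \<Longrightarrow> fenchel R T = ereal (conj_val T)"
  using fenchel_ninf[of T] by (cases "fenchel R T") (auto simp: conj_dom_def conj_val_def)

lemma Lag_eq: "Z \<in> V \<Longrightarrow> T \<in> conj_dom \<Longrightarrow> Lag Z T = ereal (lag Z T)"
  by (simp add: Lag_def lag_def fenchel_eq)

lemma Lag_infeasible: "Z \<notin> V \<Longrightarrow> Lag Z T = \<infinity>"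
  using fenchel_ninf[of T] by (cases "fenchel R T") (auto simp: Lag_def)

lemma Lag_outside_conj_dom: "Z \<in> V \<Longrightarrow> T \<notin> conj_dom \<Longrightarrow> Lag Z T = -\<infinity>"
  by (simp add: Lag_def conj_dom_def)

text \<open>The equality case of the Fenchel-Young inequality: the subgradient inequality says that
  \<open>z\<close> attains the supremum in the conjugate.\<close>

lemma subgrad_conj:
  assumes "subgrad R z T"
  shows "T \<in> conj_dom" "conj_val T = T \<bullet> z - real_of_ereal (R z)"
proof -
  obtain \<rho> where \<rho>: "R z = ereal \<rho>" using assms by (auto simp: subgrad_def)
  have "fenchel R T = ereal (T \<bullet> z - \<rho>)"
  proof (rule antisym)
    show "fenchel R T \<le> ereal (T \<bullet> z - \<rho>)"
      unfolding fenchel_def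
    proof (rule SUP_least)
      fix y
      have "ereal \<rho> + ereal (T \<bullet> (y - z)) \<le> R y"
        using assms \<rho> by (metis subgrad_def)
      then show "ereal (T \<bullet> y) - R y \<le> ereal (T \<bullet> z - \<rho>)"
        by (cases "R y") (auto simp: inner_diff_right)
    qed
    have "ereal (T \<bullet> z) - R z \<le> fenchel R T"
      unfolding fenchel_def by (rule SUP_upper) simp
    then show "ereal (T \<bullet> z - \<rho>) \<le> fenchel R T" by (simp add: \<rho>)
  qed
  then show "T \<in> conj_dom" "conj_val T = T \<bullet> z - real_of_ereal (R z)"
    by (auto simp: conj_dom_def conj_val_def \<rho>)
qed

text \<open>Infinite values cannot occur at a saddle point: comparison with 0, which lies in
  \<open>V\<close>, excludes \<open>Z\<close> outside \<open>V\<close>, and comparison with some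
  element of \<open>conj_dom\<close> excludes the value -infinity.\<close>

lemma saddle_iff:
  "(Z, T) \<in> saddle_points Lag \<longleftrightarrow>
     Z \<in> V \<and> T \<in> conj_dom \<and> (\<forall>T'\<in>conj_dom. lag Z T' \<le> lag Z T) \<and> (\<forall>Z'\<in>V. lag Z T \<le> lag Z' T)"
    (is "?l \<longleftrightarrow> ?r")
proof
  assume ?l
  then have *: "\<And>T'. Lag Z T' \<le> Lag Z T" "\<And>Z'. Lag Z T \<le> Lag Z' T"
    by (auto simp: saddle_points_def)
  have "0 \<in> V" using V_subspace by (rule subspace_0)
  then have "Lag 0 T \<noteq> \<infinity>"
    by (cases "T \<in> conj_dom") (auto simp: Lag_eq Lag_outside_conj_dom)
  then have Z: "Z \<in> V" using *(2)[of 0] Lag_infeasible[of Z T] by (metis ereal_infty_less_eq(1))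
  obtain T' where "T' \<in> conj_dom" using subgrad_exists subgrad_conj(1) by blast
  then have T: "T \<in> conj_dom"
    using *(1)[of T'] Z Lag_outside_conj_dom[of Z T]
    by (cases "T \<in> conj_dom") (auto simp: Lag_eq)
  show ?r
    using Z T *(1) *(2) Lag_eq by (metis ereal_less_eq(3))
next
  assume r: ?r
  have "Lag Z T' \<le> Lag Z T" for T'
    using r by (cases "T' \<in> conj_dom") (auto simp: Lag_eq Lag_outside_conj_dom)
  moreover have "Lag Z T \<le> Lag Z' T" for Z'
    using r by (cases "Z' \<in> V") (auto simp: Lag_eq Lag_infeasible)
  ultimately show ?l by (auto simp: saddle_points_def)
qed

lemma fenchel_young:
  assumes "T \<in> conj_dom" "R z = ereal \<rho>"
  shows "T \<bullet> z - \<rho> \<le> conj_val T"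
proof -
  have "ereal (T \<bullet> z) - R z \<le> fenchel R T"
    unfolding fenchel_def by (rule SUP_upper) simp
  then show ?thesis by (simp add: assms fenchel_eq)
qed

lemma subgrad_conj_le:
  assumes "subgrad R z T" "T' \<in> conj_dom"
  shows "conj_val T + z \<bullet> (T' - T) \<le> conj_val T'"
proof -
  obtain \<rho> where \<rho>: "R z = ereal \<rho>" using assms(1) by (auto simp: subgrad_def)
  show ?thesis
    using fenchel_young[OF assms(2) \<rho>] subgrad_conj(2)[OF assms(1)]
    by (simp add: \<rho> inner_diff_right inner_commute)
qed

section \<open>Jensen inequalities and optimality conditions\<close>

text \<open>The conjugate is a supremum of affine functions of \<open>T\<close>, so the
  Fenchel-Young inequality at each fixed \<open>z\<close> can be averaged; the finite bound also
  keeps the average inside \<open>conj_dom\<close>.\<close>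

lemma conj_jensen:
  assumes "finite I" "\<And>t. t \<in> I \<Longrightarrow> 0 \<le> w t" "(\<Sum>t\<in>I. w t) = 1" "\<And>t. t \<in> I \<Longrightarrow> T t \<in> conj_dom"
  shows "(\<Sum>t\<in>I. w t *\<^sub>R T t) \<in> conj_dom"
    and "conj_val (\<Sum>t\<in>I. w t *\<^sub>R T t) \<le> (\<Sum>t\<in>I. w t * conj_val (T t))"
proof -
  let ?T = "\<Sum>t\<in>I. w t *\<^sub>R T t"
  have le: "fenchel R ?T \<le> ereal (\<Sum>t\<in>I. w t * conj_val (T t))"
    unfolding fenchel_def
  proof (rule SUP_least)
    fix z
    show "ereal (?T \<bullet> z) - R z \<le> ereal (\<Sum>t\<in>I. w t * conj_val (T t))"
    proof (cases "R z")
      case (real \<rho>)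
      have "?T \<bullet> z - \<rho> = (\<Sum>t\<in>I. w t * (T t \<bullet> z - \<rho>))"
        by (simp add: inner_sum_left right_diff_distrib sum_subtractf sum_distrib_right[symmetric] assms(3))
      also have "\<dots> \<le> (\<Sum>t\<in>I. w t * conj_val (T t))"
        using fenchel_young[OF assms(4) real] assms(2) by (intro sum_mono mult_left_mono) auto
      finally show ?thesis by (simp add: real)
    qed (use R_ninf in auto)
  qed
  then show "?T \<in> conj_dom" by (auto simp: conj_dom_def)
  then show "conj_val ?T \<le> (\<Sum>t\<in>I. w t * conj_val (T t))"
    using le by (simp add: fenchel_eq)
qed

text \<open>Average the tangent inequalities at the mean; the linear terms cancel.\<close>

lemma F_jensen:
  assumes "finite I" "\<And>t. t \<in> I \<Longrightarrow> 0 \<le> w t" "(\<Sum>t\<in>I. w t) = 1"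
  shows "F (\<Sum>t\<in>I. w t *\<^sub>R Z t) \<le> (\<Sum>t\<in>I. w t * F (Z t))"
proof -
  let ?Z = "\<Sum>t\<in>I. w t *\<^sub>R Z t"
  have "F ?Z = (\<Sum>t\<in>I. w t * (F ?Z + g ?Z \<bullet> (Z t - ?Z)))"
  proof -
    have "(\<Sum>t\<in>I. w t * (g ?Z \<bullet> (Z t - ?Z))) = g ?Z \<bullet> (\<Sum>t\<in>I. w t *\<^sub>R (Z t - ?Z))"
      by (simp add: inner_sum_right)
    also have "(\<Sum>t\<in>I. w t *\<^sub>R (Z t - ?Z)) = 0"
      by (simp add: scaleR_right_diff_distrib sum_subtractf scaleR_left.sum[symmetric] assms(3))
    finally show ?thesis
      by (simp add: ring_distribs sum.distrib sum_distrib_right[symmetric] assms(3))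
  qed
  also have "\<dots> \<le> (\<Sum>t\<in>I. w t * F (Z t))"
    using assms(2) tangent by (intro sum_mono mult_left_mono) auto
  finally show ?thesis .
qed

lemma lag_jensen_left:
  assumes "finite I" "\<And>t. t \<in> I \<Longrightarrow> 0 \<le> w t" "(\<Sum>t\<in>I. w t) = 1"
  shows "lag (\<Sum>t\<in>I. w t *\<^sub>R Z t) T \<le> (\<Sum>t\<in>I. w t * lag (Z t) T)"
  using F_jensen[OF assms, where Z = Z] assms(3)
  by (simp add: lag_def inner_sum_right ring_distribs sum.distrib sum_subtractf
      sum_distrib_right[symmetric])

lemma lag_jensen_right:
  assumes "finite I" "\<And>t. t \<in> I \<Longrightarrow> 0 \<le> w t" "(\<Sum>t\<in>I. w t) = 1" "\<And>t. t \<in> I \<Longrightarrow> T t \<in> conj_dom"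
  shows "(\<Sum>t\<in>I. w t * lag Z (T t)) \<le> lag Z (\<Sum>t\<in>I. w t *\<^sub>R T t)"
  using conj_jensen(2)[OF assms] assms(3)
  by (simp add: lag_def inner_sum_left ring_distribs sum.distrib sum_subtractf
      sum_distrib_right[symmetric])

lemma lag_line_left:
  assumes "0 \<le> t" "t \<le> 1"
  shows "lag ((1 - t) *\<^sub>R Z + t *\<^sub>R Z') T \<le> (1 - t) * lag Z T + t * lag Z' T"
proof -
  let ?w = "\<lambda>b. if b then 1 - t else t" and ?Z = "\<lambda>b. if b then Z else Z'"
  have "lag (\<Sum>b\<in>UNIV. ?w b *\<^sub>R ?Z b) T \<le> (\<Sum>b\<in>UNIV. ?w b * lag (?Z b) T)"
    using assms by (intro lag_jensen_left) (auto simp: UNIV_bool)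
  then show ?thesis by (simp add: UNIV_bool add.commute)
qed

lemma lag_line_right:
  assumes "0 \<le> t" "t \<le> 1" "T \<in> conj_dom" "T' \<in> conj_dom"
  shows "(1 - t) *\<^sub>R T + t *\<^sub>R T' \<in> conj_dom"
    and "(1 - t) * lag Z T + t * lag Z T' \<le> lag Z ((1 - t) *\<^sub>R T + t *\<^sub>R T')"
proof -
  let ?w = "\<lambda>b. if b then 1 - t else t" and ?T = "\<lambda>b. if b then T else T'"
  have "(\<Sum>b\<in>UNIV. ?w b *\<^sub>R ?T b) \<in> conj_dom"
    using assms by (intro conj_jensen) (auto simp: UNIV_bool)
  then show "(1 - t) *\<^sub>R T + t *\<^sub>R T' \<in> conj_dom" by (simp add: UNIV_bool add.commute)
  have "(\<Sum>b\<in>UNIV. ?w b * lag Z (?T b)) \<le> lag Z (\<Sum>b\<in>UNIV. ?w b *\<^sub>R ?T b)"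
    using assms by (intro lag_jensen_right) (auto simp: UNIV_bool)
  then show "(1 - t) * lag Z T + t * lag Z T' \<le> lag Z ((1 - t) *\<^sub>R T + t *\<^sub>R T')"
    by (simp add: UNIV_bool add.commute)
qed

text \<open>Stationarity on \<open>V\<close> and the tangent inequality give minimality in
  \<open>Z\<close>; the subgradient condition, read for the conjugate, gives maximality in
  \<open>T\<close>.\<close>

lemma kkt_saddle:
  assumes "Z \<in> V" "\<And>z. z \<in> V \<Longrightarrow> (g Z + T) \<bullet> z = 0" "subgrad R Z T"
  shows "(Z, T) \<in> saddle_points Lag"
  unfolding saddle_iff
proof (intro conjI ballI)
  show "Z \<in> V" by fact
  show "T \<in> conj_dom" by (rule subgrad_conj(1)[OF assms(3)])
  fix T' assume "T' \<in> conj_dom"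
  then show "lag Z T' \<le> lag Z T"
    using subgrad_conj_le[OF assms(3), of T'] by (simp add: lag_def inner_diff_right inner_commute)
next
  fix Z' assume "Z' \<in> V"
  then have "(g Z + T) \<bullet> (Z' - Z) = 0"
    using assms(1,2) V_subspace by (simp add: subspace_diff)
  then show "lag Z T \<le> lag Z' T"
    using tangent[of Z Z'] by (simp add: lag_def inner_diff_right inner_add_left)
qed

lemma saddle_value_eq:
  assumes "(Z, T) \<in> saddle_points Lag" "(Z', T') \<in> saddle_points Lag"
  shows "lag Z T = lag Z' T'"
  using assms unfolding saddle_iff by (meson order_antisym order_trans)

section \<open>The restricted gap\<close>

text \<open>The saddle point competes in both extrema, so the supremum is at least the saddle value
  and the infimum is at most that value.\<close>

lemma gap_nonneg:
  assumes "(Z, T) \<in> saddle_points Lag" "Z \<in> B" "T \<in> C"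
  shows "0 \<le> gap Lag B C z t"
proof -
  have fin: "Lag Z T = ereal (lag Z T)"
    using assms(1) by (auto simp: saddle_iff Lag_eq)
  have "Lag Z T \<le> Lag z T" "Lag Z t \<le> Lag Z T"
    using assms(1) by (auto simp: saddle_points_def)
  then have "ereal (lag Z T) \<le> (SUP s\<in>C. Lag z s)" "(INF x\<in>B. Lag x t) \<le> ereal (lag Z T)"
    using assms(2,3) fin by (auto intro: SUP_upper2 INF_lower2)
  then have "ereal (lag Z T) - ereal (lag Z T) \<le> gap Lag B C z t"
    unfolding gap_def by (rule ereal_minus_mono)
  then show ?thesis by simp
qed

lemma gap_le:
  assumes "z \<in> V" "t \<in> conj_dom"
    and "\<And>T. T \<in> C \<Longrightarrow> T \<in> conj_dom \<Longrightarrow> lag z T \<le> u"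
    and "\<And>Z. Z \<in> B \<Longrightarrow> Z \<in> V \<Longrightarrow> l \<le> lag Z t"
  shows "gap Lag B C z t \<le> ereal (u - l)"
proof -
  have "(SUP s\<in>C. Lag z s) \<le> ereal u"
  proof (rule SUP_least)
    fix s assume "s \<in> C"
    then show "Lag z s \<le> ereal u"
      using assms(1,3) by (cases "s \<in> conj_dom") (auto simp: Lag_eq Lag_outside_conj_dom)
  qed
  moreover have "ereal l \<le> (INF x\<in>B. Lag x t)"
  proof (rule INF_greatest)
    fix x assume "x \<in> B"
    then show "ereal l \<le> Lag x t"
      using assms(2,4) by (cases "x \<in> V") (auto simp: Lag_eq Lag_infeasible)
  qed
  ultimately have "gap Lag B C z t \<le> ereal u - ereal l"
    unfolding gap_def by (rule ereal_minus_mono)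
  then show ?thesis by simp
qed

lemma gap_ge:
  assumes "z \<in> V" "t \<in> conj_dom" "T \<in> C" "T \<in> conj_dom" "Z \<in> B" "Z \<in> V"
  shows "ereal (lag z T - lag Z t) \<le> gap Lag B C z t"
proof -
  have "ereal (lag z T) \<le> (SUP s\<in>C. Lag z s)" "(INF x\<in>B. Lag x t) \<le> ereal (lag Z t)"
    using assms by (auto simp flip: Lag_eq intro: SUP_upper INF_lower)
  then have "ereal (lag z T) - ereal (lag Z t) \<le> gap Lag B C z t"
    unfolding gap_def by (rule ereal_minus_mono)
  then show ?thesis by simp
qed

text \<open>Along a segment that leaves a saddle point the Lagrangian is concave (or convex), so the gap
  over balls is at least linear in the radius at any point that is not itself a saddle point.\<close>

lemma gap_ball_linear_lower_bound:
  assumes sad: "(Z, T) \<in> saddle_points Lag" and z: "z \<in> V" "t \<in> conj_dom"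
    and nsad: "(z, t) \<notin> saddle_points Lag"
  shows "\<exists>c>0. \<forall>\<rho> B C. 0 < \<rho> \<longrightarrow> \<rho> \<le> 1 \<longrightarrow> ball Z \<rho> \<subseteq> B \<longrightarrow> ball T \<rho> \<subseteq> C \<longrightarrow>
           ereal (c * \<rho>) \<le> gap Lag B C z t"
proof -
  define val where "val = lag Z T"
  have Z: "Z \<in> V" and T: "T \<in> conj_dom" and zT: "val \<le> lag z T" and Zt: "lag Z t \<le> val"
    using sad z by (auto simp: saddle_iff val_def)
  \<comment> \<open>Otherwise \<open>lag z T' \<le> val \<le> lag Z' t\<close> throughout;
    \<open>T' = t\<close> and \<open>Z' = z\<close> give \<open>lag z t = val\<close>, and
    \<open>(z, t)\<close> would be a saddle point.\<close>
  have "(\<exists>T'\<in>conj_dom. val < lag z T') \<or> (\<exists>Z'\<in>V. lag Z' t < val)"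
  proof (rule ccontr)
    assume "\<not> ?thesis"
    then have "\<forall>T'\<in>conj_dom. lag z T' \<le> val" "\<forall>Z'\<in>V. val \<le> lag Z' t"
      by (auto simp: not_less)
    then show False
      using nsad z by (auto simp: saddle_iff intro: order_trans)
  qed
  then show ?thesis
  proof
    assume "\<exists>T'\<in>conj_dom. val < lag z T'"
    then obtain T' where T': "T' \<in> conj_dom" "val < lag z T'" by blast
    \<comment> \<open>\<open>n\<close> exceeds the distance to \<open>T'\<close> and is at least 1,
      so the point at fraction \<open>q = \<rho> / n\<close> of the segment lies in the open ball
      and \<open>q \<le> 1\<close>. The gain is at least \<open>q\<close> times
      \<open>lag z T' - val\<close>.\<close>
    define n where "n = 1 + norm (T' - T)"
    have n: "1 \<le> n" "norm (T' - T) < n" by (auto simp: n_def)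
    have "ereal ((lag z T' - val) / n * \<rho>) \<le> gap Lag B C z t"
      if \<rho>: "0 < \<rho>" "\<rho> \<le> 1" and B: "ball Z \<rho> \<subseteq> B" "ball T \<rho> \<subseteq> C" for \<rho> B C
    proof -
      define q where "q = \<rho> / n"
      have q: "0 < q" "q \<le> 1" using \<rho> n by (auto simp: q_def divide_simps)
      define S where "S = (1 - q) *\<^sub>R T + q *\<^sub>R T'"
      have "S - T = q *\<^sub>R (T' - T)" by (simp add: S_def algebra_simps)
      then have "norm (S - T) = q * norm (T' - T)" using q by simp
      also have "\<dots> < q * n" using q n by (intro mult_strict_left_mono) auto
      also have "\<dots> = \<rho>" using n by (simp add: q_def)
      finally have "S \<in> C" using B by (auto simp: dist_norm norm_minus_commute)
      moreover have "Z \<in> B" using B \<rho> by auto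
      ultimately have "ereal (lag z S - lag Z t) \<le> gap Lag B C z t"
        using lag_line_right(1)[of q T T'] q T T' Z z by (intro gap_ge) (auto simp: S_def)
      moreover have "(1 - q) * val + q * lag z T' \<le> (1 - q) * lag z T + q * lag z T'"
        using q zT by (intro add_right_mono mult_left_mono) auto
      then have "(1 - q) * val + q * lag z T' \<le> lag z S"
        using lag_line_right(2)[of q T T' z] q T T' by (simp add: S_def)
      then have "(lag z T' - val) / n * \<rho> \<le> lag z S - lag Z t"
        using Zt by (simp add: q_def algebra_simps diff_divide_distrib)
      ultimately show ?thesis by (meson ereal_less_eq(3) order_trans)
    qed
    then show ?thesis
      using T' n by (intro exI[of _ "(lag z T' - val) / n"]) (auto intro!: divide_pos_pos)
  next
    assume "\<exists>Z'\<in>V. lag Z' t < val"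
    then obtain Z' where Z': "Z' \<in> V" "lag Z' t < val" by blast
    define n where "n = 1 + norm (Z' - Z)"
    have n: "1 \<le> n" "norm (Z' - Z) < n" by (auto simp: n_def)
    have "ereal ((val - lag Z' t) / n * \<rho>) \<le> gap Lag B C z t"
      if \<rho>: "0 < \<rho>" "\<rho> \<le> 1" and B: "ball Z \<rho> \<subseteq> B" "ball T \<rho> \<subseteq> C" for \<rho> B C
    proof -
      define q where "q = \<rho> / n"
      have q: "0 < q" "q \<le> 1" using \<rho> n by (auto simp: q_def divide_simps)
      define S where "S = (1 - q) *\<^sub>R Z + q *\<^sub>R Z'"
      have "S - Z = q *\<^sub>R (Z' - Z)" by (simp add: S_def algebra_simps)
      then have "norm (S - Z) = q * norm (Z' - Z)" using q by simp
      also have "\<dots> < q * n" using q n by (intro mult_strict_left_mono) auto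
      also have "\<dots> = \<rho>" using n by (simp add: q_def)
      finally have "S \<in> B" using B by (auto simp: dist_norm norm_minus_commute)
      moreover have "S \<in> V"
        using Z Z' V_subspace by (simp add: S_def subspace_add subspace_scale)
      moreover have "T \<in> C" using B \<rho> by auto
      ultimately have "ereal (lag z T - lag S t) \<le> gap Lag B C z t"
        using T z by (intro gap_ge) auto
      moreover have "(1 - q) * lag Z t + q * lag Z' t \<le> (1 - q) * val + q * lag Z' t"
        using q Zt by (intro add_right_mono mult_left_mono) auto
      then have "lag S t \<le> (1 - q) * val + q * lag Z' t"
        using lag_line_left[of q Z Z' t] q by (simp add: S_def)
      then have "(val - lag Z' t) / n * \<rho> \<le> lag z T - lag S t"
        using zT by (simp add: q_def algebra_simps diff_divide_distrib)
      ultimately show ?thesis by (meson ereal_less_eq(3) order_trans)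
    qed
    then show ?thesis
      using Z' n by (intro exI[of _ "(val - lag Z' t) / n"]) (auto intro!: divide_pos_pos)
  qed
qed

end

subsection \<open>The splitting iteration\<close>

text \<open>Read \<open>p\<close> as the new \<open>x\<close>, \<open>v\<close> as the increment of
  \<open>s\<close> and \<open>p + W v\<close> as the projected point \<open>A\<close>. The cross
  terms of one step combine into differences of squares that telescope up to the weight.\<close>

lemma step_identity:
  fixes x z p v s t :: "'a::real_inner" and W :: real
  shows "2 * ((x - (p + W *\<^sub>R v)) \<bullet> (p + W *\<^sub>R v - z)) - 2 * W * (s \<bullet> (p + W *\<^sub>R v - z))
      + 2 * W * (t \<bullet> (p + W *\<^sub>R v) - (s + v) \<bullet> z - p \<bullet> (t - (s + v)))
    = (norm (x - z))\<^sup>2 - (norm (p - z))\<^sup>2 + W\<^sup>2 * ((norm (s - t))\<^sup>2 - (norm (s + v - t))\<^sup>2)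
      - (norm (x - (p + W *\<^sub>R v)))\<^sup>2"
  unfolding power2_norm_eq_inner
  by (simp add: inner_simps inner_commute power2_eq_square algebra_simps)

text \<open>\<open>w (Suc k)\<close> is the stepsize that leads from \<open>x k\<close> to
  \<open>x (Suc k)\<close>, so \<open>w 0\<close> is the initial one and the lower bound starts at
  index 1. \<open>A_in_V\<close> and \<open>A_orth\<close> together say that
  \<open>A (Suc k)\<close> is the orthogonal projection of the gradient step onto \<open>V\<close>.
  From \<open>N\<close> on the agents share their stepsize.\<close>

locale splitting_run = constrained_lagrangian F g V R
  for F :: "'a::euclidean_space \<Rightarrow> real" and g V R +
  fixes x s A :: "nat \<Rightarrow> 'a" and w :: "nat \<Rightarrow> real" and N :: nat and \<delta> lo hi :: real
  assumes g_cont: "isCont g z"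
    and R_closed: "(\<And>n. subgrad R (xs n) (ss n)) \<Longrightarrow> xs \<longlonglongrightarrow> z \<Longrightarrow> ss \<longlonglongrightarrow> t \<Longrightarrow> subgrad R z t"
    and \<delta>: "\<delta> < 1" and lo: "0 < lo"
    and w_lo: "1 \<le> k \<Longrightarrow> lo \<le> w k" and N1: "1 \<le> N"
    and w_hi: "N \<le> k \<Longrightarrow> w k \<le> hi" and w_mono: "N \<le> k \<Longrightarrow> w k \<le> w (Suc k)"
    and A_in_V: "N \<le> k \<Longrightarrow> A (Suc k) \<in> V"
    and A_orth: "N \<le> k \<Longrightarrow> z \<in> V \<Longrightarrow> (x k - w (Suc k) *\<^sub>R (g (x k) + s k) - A (Suc k)) \<bullet> z = 0"
    and s_Suc: "N \<le> k \<Longrightarrow> s (Suc k) = s k + (1 / w (Suc k)) *\<^sub>R (A (Suc k) - x (Suc k))"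
    and sub: "N \<le> k \<Longrightarrow> subgrad R (x (Suc k)) (s (Suc k))"
    and descent: "N \<le> k \<Longrightarrow> F (A (Suc k)) \<le> F (x k) + g (x k) \<bullet> (A (Suc k) - x k)
        + \<delta> / (2 * w (Suc k)) * (norm (A (Suc k) - x k))\<^sup>2"
begin

lemma w_pos: "N \<le> k \<Longrightarrow> 0 < w k"
  using w_lo[of k] lo N1 by linarith

lemma hi_pos: "0 < hi"
  using w_pos[of N] w_hi[of N] by simp

lemma s_in_conj_dom: "N < k \<Longrightarrow> s k \<in> conj_dom"
  using sub[of "k - 1"] subgrad_conj(1) by (cases k) auto

lemma A_in_V': "N < k \<Longrightarrow> A k \<in> V"
  using A_in_V[of "k - 1"] by (cases k) auto

text \<open>The accepted step and the tangent at \<open>x k\<close> bound the difference of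
  \<open>F\<close>, the subgradient at \<open>x (Suc k)\<close> bounds the difference of conjugates,
  and orthogonality expresses \<open>g (x k)\<close> through \<open>x k - A (Suc k)\<close> and
  \<open>s k\<close>. The identity above turns the sum into squares.\<close>

lemma step_inequality:
  assumes k: "N \<le> k" and z: "z \<in> V" and t: "t \<in> conj_dom"
  shows "2 * w (Suc k) * (lag (A (Suc k)) t - lag z (s (Suc k)))
    \<le> (norm (x k - z))\<^sup>2 - (norm (x (Suc k) - z))\<^sup>2
      + (w (Suc k))\<^sup>2 * ((norm (s k - t))\<^sup>2 - (norm (s (Suc k) - t))\<^sup>2)
      - (1 - \<delta>) * (norm (x k - A (Suc k)))\<^sup>2"
proof -
  define W where "W = w (Suc k)"
  have W: "0 < W" using w_pos[of "Suc k"] k by (simp add: W_def)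
  define v where "v = s (Suc k) - s k"
  have s': "s (Suc k) = s k + v" by (simp add: v_def)
  have "W *\<^sub>R v = A (Suc k) - x (Suc k)"
    using s_Suc[OF k] W by (simp add: v_def W_def)
  then have A': "A (Suc k) = x (Suc k) + W *\<^sub>R v" by simp
  have q: "(norm (A (Suc k) - x k))\<^sup>2 = (norm (x k - A (Suc k)))\<^sup>2" by (simp add: norm_minus_commute)
  define G where "G = g (x k) \<bullet> (A (Suc k) - z)"
  define H where "H = t \<bullet> A (Suc k) - s (Suc k) \<bullet> z - x (Suc k) \<bullet> (t - s (Suc k))"
  have "lag (A (Suc k)) t - lag z (s (Suc k)) \<le> G + H + \<delta> / (2 * W) * (norm (x k - A (Suc k)))\<^sup>2"
    using descent[OF k] tangent[of "x k" z] subgrad_conj_le[OF sub[OF k] t]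
    by (simp add: lag_def G_def H_def q W_def inner_diff_right)
  then have "2 * W * (lag (A (Suc k)) t - lag z (s (Suc k)))
      \<le> 2 * W * (G + H + \<delta> / (2 * W) * (norm (x k - A (Suc k)))\<^sup>2)"
    using W by (intro mult_left_mono) auto
  also have "\<dots> = 2 * W * G + 2 * W * H + \<delta> * (norm (x k - A (Suc k)))\<^sup>2"
    using W by (simp add: distrib_left)
  also have "2 * W * G = 2 * ((x k - A (Suc k)) \<bullet> (A (Suc k) - z)) - 2 * W * (s k \<bullet> (A (Suc k) - z))"
  proof -
    have "A (Suc k) - z \<in> V" using A_in_V[OF k] z V_subspace by (simp add: subspace_diff)
    from A_orth[OF k this] show ?thesis
      by (simp add: G_def W_def inner_diff_left inner_add_left algebra_simps)
  qed
  also have "2 * ((x k - A (Suc k)) \<bullet> (A (Suc k) - z)) - 2 * W * (s k \<bullet> (A (Suc k) - z)) + 2 * W * H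
    = (norm (x k - z))\<^sup>2 - (norm (x (Suc k) - z))\<^sup>2
      + W\<^sup>2 * ((norm (s k - t))\<^sup>2 - (norm (s (Suc k) - t))\<^sup>2) - (norm (x k - A (Suc k)))\<^sup>2"
    unfolding H_def A' s' by (rule step_identity)
  finally show ?thesis by (simp add: W_def algebra_simps)
qed

section \<open>Fejer monotonicity and convergence\<close>

text \<open>The primal part is divided by \<open>(w k)\<^sup>2\<close>, because then a growing
  stepsize can only lower the sum; a factor \<open>(w k)\<^sup>2\<close> on the dual part could
  raise it.\<close>

definition dist_sq :: "'a \<Rightarrow> 'a \<Rightarrow> nat \<Rightarrow> real" where
  "dist_sq Z T k = (norm (x k - Z))\<^sup>2 / (w k)\<^sup>2 + (norm (s k - T))\<^sup>2"

lemma dist_sq_nonneg: "0 \<le> dist_sq Z T k"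
  by (simp add: dist_sq_def)

lemma saddle_gap_term_nonneg:
  assumes "(Z, T) \<in> saddle_points Lag" "N < k"
  shows "0 \<le> lag (A k) T - lag Z (s k)"
  using assms A_in_V'[of k] s_in_conj_dom[of k] unfolding saddle_iff by force

text \<open>This is the step inequality divided by \<open>(w (Suc k))\<^sup>2\<close>. At a saddle
  point the error terms are nonnegative, so their divisor may be enlarged to
  \<open>hi\<^sup>2\<close>; monotonicity of \<open>w\<close> handles the primal term.\<close>

lemma dist_sq_decrease:
  assumes sad: "(Z, T) \<in> saddle_points Lag" and k: "N \<le> k"
  shows "dist_sq Z T (Suc k) + (1 - \<delta>) / hi\<^sup>2 * (norm (x k - A (Suc k)))\<^sup>2
      + 2 / hi\<^sup>2 * (w (Suc k) * (lag (A (Suc k)) T - lag Z (s (Suc k)))) \<le> dist_sq Z T k"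
proof -
  define W where "W = w (Suc k)"
  define e where "e = (1 - \<delta>) * (norm (x k - A (Suc k)))\<^sup>2 + 2 * (w (Suc k) * (lag (A (Suc k)) T - lag Z (s (Suc k))))"
  have W: "0 < W" "W \<le> hi" "w k \<le> W" "0 < w k"
    using w_pos[of "Suc k"] w_pos[of k] w_hi[of "Suc k"] w_mono[of k] k by (auto simp: W_def)
  have e0: "0 \<le> e"
    using saddle_gap_term_nonneg[OF sad, of "Suc k"] k \<delta> W by (auto simp: e_def W_def)
  have "e / hi\<^sup>2 \<le> e / W\<^sup>2"
    using W e0 by (intro divide_left_mono power_mono) auto
  moreover have "(norm (x k - Z))\<^sup>2 / W\<^sup>2 \<le> (norm (x k - Z))\<^sup>2 / (w k)\<^sup>2"
    using W by (intro divide_left_mono power_mono) auto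
  moreover have "e \<le> (norm (x k - Z))\<^sup>2 - (norm (x (Suc k) - Z))\<^sup>2
      + W\<^sup>2 * ((norm (s k - T))\<^sup>2 - (norm (s (Suc k) - T))\<^sup>2)"
    using step_inequality[OF k, of Z T] sad by (auto simp: saddle_iff e_def W_def)
  then have "e / W\<^sup>2 \<le> ((norm (x k - Z))\<^sup>2 - (norm (x (Suc k) - Z))\<^sup>2
      + W\<^sup>2 * ((norm (s k - T))\<^sup>2 - (norm (s (Suc k) - T))\<^sup>2)) / W\<^sup>2"
    by (intro divide_right_mono) auto
  then have "e / W\<^sup>2 \<le> (norm (x k - Z))\<^sup>2 / W\<^sup>2 - (norm (x (Suc k) - Z))\<^sup>2 / W\<^sup>2
      + ((norm (s k - T))\<^sup>2 - (norm (s (Suc k) - T))\<^sup>2)"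
    using W by (simp add: add_divide_distrib diff_divide_distrib)
  moreover have "e / hi\<^sup>2 = (1 - \<delta>) / hi\<^sup>2 * (norm (x k - A (Suc k)))\<^sup>2
      + 2 / hi\<^sup>2 * (w (Suc k) * (lag (A (Suc k)) T - lag Z (s (Suc k))))"
    by (simp add: e_def add_divide_distrib)
  ultimately show ?thesis by (simp add: dist_sq_def W_def)
qed

lemma dist_sq_Suc_le:
  assumes "(Z, T) \<in> saddle_points Lag" "N \<le> k"
  shows "dist_sq Z T (Suc k) \<le> dist_sq Z T k"
    and "(1 - \<delta>) / hi\<^sup>2 * (norm (x k - A (Suc k)))\<^sup>2 \<le> dist_sq Z T k - dist_sq Z T (Suc k)"
    and "2 / hi\<^sup>2 * (w (Suc k) * (lag (A (Suc k)) T - lag Z (s (Suc k)))) \<le> dist_sq Z T k - dist_sq Z T (Suc k)"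
proof -
  have a: "0 \<le> (1 - \<delta>) / hi\<^sup>2 * (norm (x k - A (Suc k)))\<^sup>2" using \<delta> by simp
  have b: "0 \<le> 2 / hi\<^sup>2 * (w (Suc k) * (lag (A (Suc k)) T - lag Z (s (Suc k))))"
    using saddle_gap_term_nonneg[OF assms(1), of "Suc k"] w_pos[of "Suc k"] assms(2) by simp
  note * = dist_sq_decrease[OF assms]
  show "dist_sq Z T (Suc k) \<le> dist_sq Z T k"
    and "(1 - \<delta>) / hi\<^sup>2 * (norm (x k - A (Suc k)))\<^sup>2 \<le> dist_sq Z T k - dist_sq Z T (Suc k)"
    and "2 / hi\<^sup>2 * (w (Suc k) * (lag (A (Suc k)) T - lag Z (s (Suc k)))) \<le> dist_sq Z T k - dist_sq Z T (Suc k)"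
    using * a b by linarith+
qed

lemma dist_sq_antimono:
  assumes "(Z, T) \<in> saddle_points Lag" "N \<le> k" "k \<le> l"
  shows "dist_sq Z T l \<le> dist_sq Z T k"
  using assms(3)
proof (induction l rule: dec_induct)
  case (step n)
  then show ?case using dist_sq_Suc_le(1)[OF assms(1), of n] assms(2) by linarith
qed simp

lemma dist_sq_convergent:
  assumes "(Z, T) \<in> saddle_points Lag"
  shows "\<exists>l. dist_sq Z T \<longlonglongrightarrow> l"
proof -
  have "decseq (\<lambda>n. dist_sq Z T (n + N))"
    unfolding decseq_def by (intro allI impI dist_sq_antimono[OF assms]) auto
  then obtain l where "(\<lambda>n. dist_sq Z T (n + N)) \<longlonglongrightarrow> l"
    using decseq_convergent[of "\<lambda>n. dist_sq Z T (n + N)" 0] dist_sq_nonneg by metis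
  then show ?thesis using LIMSEQ_offset by blast
qed

text \<open>The squared norms are dominated, up to a constant, by the decrements of the convergent
  sequence \<open>dist_sq Z T\<close>.\<close>

lemma x_minus_A_tendsto_0:
  assumes "(Z, T) \<in> saddle_points Lag"
  shows "(\<lambda>k. x k - A (Suc k)) \<longlonglongrightarrow> 0"
proof -
  obtain l where l: "dist_sq Z T \<longlonglongrightarrow> l" using dist_sq_convergent[OF assms] by blast
  have c: "0 < (1 - \<delta>) / hi\<^sup>2" using \<delta> hi_pos by simp
  have "(\<lambda>k. dist_sq Z T k - dist_sq Z T (Suc k)) \<longlonglongrightarrow> l - l"
    by (intro tendsto_diff l LIMSEQ_Suc)
  then have d: "(\<lambda>k. dist_sq Z T k - dist_sq Z T (Suc k)) \<longlonglongrightarrow> 0" by simp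
  have "(\<lambda>k. (1 - \<delta>) / hi\<^sup>2 * (norm (x k - A (Suc k)))\<^sup>2) \<longlonglongrightarrow> 0"
  proof (rule tendsto_sandwich[OF _ _ tendsto_const d])
    show "\<forall>\<^sub>F k in sequentially. 0 \<le> (1 - \<delta>) / hi\<^sup>2 * (norm (x k - A (Suc k)))\<^sup>2"
      using \<delta> by simp
    show "\<forall>\<^sub>F k in sequentially. (1 - \<delta>) / hi\<^sup>2 * (norm (x k - A (Suc k)))\<^sup>2 \<le> dist_sq Z T k - dist_sq Z T (Suc k)"
      using dist_sq_Suc_le(2)[OF assms] by (auto simp: eventually_at_top_linorder)
  qed
  then have "(\<lambda>k. (norm (x k - A (Suc k)))\<^sup>2) \<longlonglongrightarrow> 0"
    using tendsto_mult_left_iff[of "(1 - \<delta>) / hi\<^sup>2" "\<lambda>k. (norm (x k - A (Suc k)))\<^sup>2" 0] c by force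
  then show ?thesis
    by (simp add: tendsto_norm_zero_iff)
qed

lemma norm_x_le:
  assumes "N \<le> k" shows "(norm (x k - Z))\<^sup>2 \<le> hi\<^sup>2 * dist_sq Z T k"
proof -
  have w: "0 < w k" "w k \<le> hi" using w_pos w_hi assms by auto
  have "(norm (x k - Z))\<^sup>2 = (w k)\<^sup>2 * ((norm (x k - Z))\<^sup>2 / (w k)\<^sup>2)" using w by simp
  also have "\<dots> \<le> hi\<^sup>2 * dist_sq Z T k"
    using w by (intro mult_mono power_mono) (auto simp: dist_sq_def)
  finally show ?thesis .
qed

lemma norm_s_le: "(norm (s k - T))\<^sup>2 \<le> dist_sq Z T k"
  by (simp add: dist_sq_def)

text \<open>The optimality conditions pass to the limit: \<open>x - A\<close> vanishes, so the limit
  lies in the closed set \<open>V\<close>; the subgradient relation is closed; and orthogonality,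
  divided by a stepsize of at least \<open>lo\<close>, leaves stationarity.\<close>

lemma cluster_point_saddle:
  assumes sad: "(Z, T) \<in> saddle_points Lag" and r: "filterlim r at_top sequentially"
    and lim: "(\<lambda>n. x (r n)) \<longlonglongrightarrow> Z'" "(\<lambda>n. s (r n)) \<longlonglongrightarrow> T'"
    and rN: "\<And>n. N < r n"
  shows "(Z', T') \<in> saddle_points Lag"
proof (rule kkt_saddle)
  have A0: "(\<lambda>n. x (r n) - A (Suc (r n))) \<longlonglongrightarrow> 0"
    using x_minus_A_tendsto_0[OF sad] r by (rule filterlim_compose)
  from tendsto_diff[OF lim(1) this] have AZ: "(\<lambda>n. A (Suc (r n))) \<longlonglongrightarrow> Z'" by simp
  have AV: "\<And>n. A (Suc (r n)) \<in> V" using A_in_V[OF less_imp_le[OF rN]] .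
  show "Z' \<in> V"
    by (rule closed_sequentially[OF closed_subspace[OF V_subspace] AV AZ])
  have "subgrad R (x (r n)) (s (r n))" for n
    using sub[of "r n - 1"] rN[of n] by (cases "r n") auto
  then show "subgrad R Z' T'" using lim by (rule R_closed)
  fix z assume z: "z \<in> V"
  have "(\<lambda>n. (g (x (r n)) + s (r n)) \<bullet> z) \<longlonglongrightarrow> (g Z' + T') \<bullet> z"
    by (intro tendsto_intros lim isCont_tendsto_compose[OF g_cont])
  moreover have "(\<lambda>n. (g (x (r n)) + s (r n)) \<bullet> z) \<longlonglongrightarrow> 0"
  proof (rule tendsto_0_le)
    show "(\<lambda>n. (x (r n) - A (Suc (r n))) \<bullet> z) \<longlonglongrightarrow> 0"
      using tendsto_inner[OF A0 tendsto_const[of z]] by simp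
    have "norm ((g (x (r n)) + s (r n)) \<bullet> z) \<le> norm ((x (r n) - A (Suc (r n))) \<bullet> z) * (1 / lo)" for n
    proof -
      define W where "W = w (Suc (r n))"
      have W: "lo \<le> W" using w_lo by (simp add: W_def)
      have "(x (r n) - A (Suc (r n))) \<bullet> z = W * ((g (x (r n)) + s (r n)) \<bullet> z)"
        using A_orth[of "r n" z] rN[of n] z by (simp add: W_def inner_diff_left inner_add_left algebra_simps)
      then have "norm ((x (r n) - A (Suc (r n))) \<bullet> z) = W * norm ((g (x (r n)) + s (r n)) \<bullet> z)"
        using W lo by (simp add: abs_mult)
      moreover have "lo * norm ((g (x (r n)) + s (r n)) \<bullet> z) \<le> W * norm ((g (x (r n)) + s (r n)) \<bullet> z)"
        using W by (intro mult_right_mono) auto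
      ultimately show ?thesis using lo by (simp add: field_simps)
    qed
    then show "\<forall>\<^sub>F n in sequentially. norm ((g (x (r n)) + s (r n)) \<bullet> z) \<le> norm ((x (r n) - A (Suc (r n))) \<bullet> z) * (1 / lo)"
      by simp
  qed
  ultimately show "(g Z' + T') \<bullet> z = 0" using LIMSEQ_unique by blast
qed

text \<open>Boundedness gives a cluster point, which is a saddle point. The weighted distance to
  this very point converges and has a subsequence tending to 0, so the whole sequence
  converges.\<close>

theorem converges_to_saddle:
  assumes "saddle_points Lag \<noteq> {}"
  obtains Z T where "(Z, T) \<in> saddle_points Lag" "x \<longlonglongrightarrow> Z" "s \<longlonglongrightarrow> T"
proof -
  obtain Z0 T0 where sad0: "(Z0, T0) \<in> saddle_points Lag" using assms by auto
  define U where "U = dist_sq Z0 T0 N"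
  have bs: "norm (s k) \<le> sqrt U + norm T0" and bx: "norm (x k) \<le> sqrt (hi\<^sup>2 * U) + norm Z0"
    if k: "N \<le> k" for k
  proof -
    have U: "dist_sq Z0 T0 k \<le> U" using dist_sq_antimono[OF sad0 _ k] by (simp add: U_def)
    then have "(norm (s k - T0))\<^sup>2 \<le> U" using norm_s_le[of k T0 Z0] by linarith
    then have "norm (s k - T0) \<le> sqrt U" by (rule real_le_rsqrt)
    then show "norm (s k) \<le> sqrt U + norm T0" using norm_triangle_sub[of "s k" T0] by linarith
    have "(norm (x k - Z0))\<^sup>2 \<le> hi\<^sup>2 * U"
      using norm_x_le[OF k, of Z0 T0] U mult_left_mono[OF U, of "hi\<^sup>2"] by simp
    then have "norm (x k - Z0) \<le> sqrt (hi\<^sup>2 * U)" by (rule real_le_rsqrt)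
    then show "norm (x k) \<le> sqrt (hi\<^sup>2 * U) + norm Z0" using norm_triangle_sub[of "x k" Z0] by linarith
  qed
  define p where "p n = (x (Suc (n + N)), s (Suc (n + N)))" for n
  have "norm (p n) \<le> (sqrt (hi\<^sup>2 * U) + norm Z0) + (sqrt U + norm T0)" for n
    using bs[of "Suc (n + N)"] bx[of "Suc (n + N)"] norm_Pair_le[of "x (Suc (n + N))" "s (Suc (n + N))"]
    by (simp add: p_def)
  then have "bounded (range p)" by (auto simp: bounded_iff)
  then obtain l r where r: "strict_mono r" and l: "(p \<circ> r) \<longlonglongrightarrow> l"
    using bounded_imp_convergent_subsequence by metis
  obtain Z T where l': "l = (Z, T)" by (cases l)
  define q where "q n = Suc (r n + N)" for n
  have lim: "(\<lambda>n. x (q n)) \<longlonglongrightarrow> Z" "(\<lambda>n. s (q n)) \<longlonglongrightarrow> T"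
    using tendsto_fst[OF l] tendsto_snd[OF l] by (simp_all add: l' p_def q_def o_def)
  have q: "filterlim q at_top sequentially"
  proof (rule filterlim_subseq)
    show "strict_mono q" using r by (auto simp: strict_mono_def q_def)
  qed
  have sad: "(Z, T) \<in> saddle_points Lag"
    by (rule cluster_point_saddle[OF sad0 q lim]) (simp add: q_def)
  obtain u where u: "dist_sq Z T \<longlonglongrightarrow> u" using dist_sq_convergent[OF sad] by blast
  then have "(\<lambda>n. dist_sq Z T (q n)) \<longlonglongrightarrow> u" using q by (rule filterlim_compose)
  moreover have "(\<lambda>n. dist_sq Z T (q n)) \<longlonglongrightarrow> 0"
  proof (rule tendsto_sandwich[OF _ _ tendsto_const])
    have "(\<lambda>n. (norm (x (q n) - Z))\<^sup>2 / lo\<^sup>2 + (norm (s (q n) - T))\<^sup>2)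
        \<longlonglongrightarrow> (norm (Z - Z))\<^sup>2 / lo\<^sup>2 + (norm (T - T))\<^sup>2"
      using lo by (intro tendsto_intros lim) simp
    then show "(\<lambda>n. (norm (x (q n) - Z))\<^sup>2 / lo\<^sup>2 + (norm (s (q n) - T))\<^sup>2) \<longlonglongrightarrow> 0" by simp
    have "dist_sq Z T (q n) \<le> (norm (x (q n) - Z))\<^sup>2 / lo\<^sup>2 + (norm (s (q n) - T))\<^sup>2" for n
      unfolding dist_sq_def using w_lo[of "q n"] lo
      by (intro add_right_mono divide_left_mono power_mono) (auto simp: q_def)
    then show "\<forall>\<^sub>F n in sequentially. dist_sq Z T (q n) \<le> (norm (x (q n) - Z))\<^sup>2 / lo\<^sup>2 + (norm (s (q n) - T))\<^sup>2"
      by simp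
  qed (simp add: dist_sq_nonneg)
  ultimately have u0: "dist_sq Z T \<longlonglongrightarrow> 0" using u LIMSEQ_unique by blast
  have d: "(\<lambda>k. hi\<^sup>2 * dist_sq Z T k) \<longlonglongrightarrow> 0" using tendsto_mult_right_zero[OF u0] by simp
  have "(\<lambda>k. (norm (x k - Z))\<^sup>2) \<longlonglongrightarrow> 0"
    by (rule tendsto_sandwich[OF _ _ tendsto_const d])
      (auto simp: eventually_at_top_linorder intro!: norm_x_le)
  moreover have "(\<lambda>k. (norm (s k - T))\<^sup>2) \<longlonglongrightarrow> 0"
    by (rule tendsto_sandwich[OF _ _ tendsto_const u0]) (simp_all add: norm_s_le)
  ultimately have "x \<longlonglongrightarrow> Z" "s \<longlonglongrightarrow> T"
    by (simp_all add: tendsto_norm_zero_iff LIM_zero_iff)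
  with sad that show ?thesis by blast
qed

section \<open>Ergodic rate\<close>

text \<open>At a saddle point the gap terms are dominated by the decrements of
  \<open>dist_sq\<close>, so sums over late blocks are small by the Cauchy property.\<close>

lemma saddle_gap_tail:
  assumes sad: "(Z, T) \<in> saddle_points Lag" and "0 < \<epsilon>"
  shows "\<exists>K0\<ge>N. \<forall>K\<ge>K0. \<forall>k\<ge>K. (\<Sum>t=Suc K..k. w t * (lag (A t) T - lag Z (s t))) \<le> \<epsilon>"
proof -
  obtain l where l: "dist_sq Z T \<longlonglongrightarrow> l" using dist_sq_convergent[OF sad] by blast
  then have "Cauchy (dist_sq Z T)" by (rule LIMSEQ_imp_Cauchy)
  moreover have "0 < 2 / hi\<^sup>2 * \<epsilon>" using \<open>0 < \<epsilon>\<close> hi_pos by simp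
  ultimately obtain M where M: "\<And>m n. M \<le> m \<Longrightarrow> M \<le> n \<Longrightarrow> dist (dist_sq Z T m) (dist_sq Z T n) < 2 / hi\<^sup>2 * \<epsilon>"
    unfolding Cauchy_def by metis
  have "(\<Sum>t=Suc K..k. w t * (lag (A t) T - lag Z (s t))) \<le> \<epsilon>" if K: "max M N \<le> K" "K \<le> k" for K k
  proof -
    have "2 / hi\<^sup>2 * (\<Sum>t=Suc K..k. w t * (lag (A t) T - lag Z (s t))) \<le> dist_sq Z T K - dist_sq Z T k"
      using K(2)
    proof (induction k rule: dec_induct)
      case (step n)
      then show ?case
        using dist_sq_Suc_le(3)[OF sad, of n] K by (simp add: distrib_left)
    qed simp
    also have "\<dots> \<le> 2 / hi\<^sup>2 * \<epsilon>" using M[of K k] K by (simp add: dist_real_def)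
    finally show ?thesis using hi_pos by (simp add: divide_simps)
  qed
  then show ?thesis by (intro exI[of _ "max M N"]) auto
qed

text \<open>For a general pair \<open>dist_sq\<close> need not decrease. The step inequalities are
  summed by parts instead, and \<open>c\<close> pays for the growth of the weights in front of the
  dual distances.\<close>

lemma gap_sum_le:
  assumes z: "z \<in> V" and t: "t \<in> conj_dom" and K: "N \<le> K" "K \<le> k"
    and c: "\<And>j. K \<le> j \<Longrightarrow> (norm (s j - t))\<^sup>2 \<le> c"
  shows "2 * (\<Sum>j=Suc K..k. w j * (lag (A j) t - lag z (s j))) \<le> (norm (x K - z))\<^sup>2 + hi\<^sup>2 * c"
proof -
  have "0 \<le> c" using c[of K] zero_le_power2[of "norm (s K - t)"] by linarith
  \<comment> \<open>The terms at the last index are kept so that the induction closes: passing from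
    \<open>w n\<close> to \<open>w (Suc n)\<close> costs \<open>((w (Suc n))\<^sup>2 - (w
    n)\<^sup>2) * (norm (s n - t))\<^sup>2\<close>, at most the same increment times
    \<open>c\<close>.\<close>
  have "2 * (\<Sum>j=Suc K..k. w j * (lag (A j) t - lag z (s j)))
      \<le> (norm (x K - z))\<^sup>2 - (norm (x k - z))\<^sup>2 + (w k)\<^sup>2 * c - (w k)\<^sup>2 * (norm (s k - t))\<^sup>2"
    using K(2)
  proof (induction k rule: dec_induct)
    case base
    then show ?case using mult_left_mono[OF c[of K], of "(w K)\<^sup>2"] by simp
  next
    case (step n)
    have "w n \<le> w (Suc n)" "0 < w n" using w_mono w_pos K step by auto
    then have "(w n)\<^sup>2 \<le> (w (Suc n))\<^sup>2" by (intro power_mono) auto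
    then have "0 \<le> ((w (Suc n))\<^sup>2 - (w n)\<^sup>2) * (c - (norm (s n - t))\<^sup>2)"
      using c[of n] step by (intro mult_nonneg_nonneg) auto
    moreover have "0 \<le> (1 - \<delta>) * (norm (x n - A (Suc n)))\<^sup>2" using \<delta> by simp
    ultimately show ?case
      using step step_inequality[of n z t] z t K by (simp add: algebra_simps)
  qed
  also have "\<dots> \<le> (norm (x K - z))\<^sup>2 + (w k)\<^sup>2 * c"
    using zero_le_power2[of "norm (x k - z)"] zero_le_power2[of "w k * norm (s k - t)"]
    unfolding power_mult_distrib by linarith
  also have "\<dots> \<le> (norm (x K - z))\<^sup>2 + hi\<^sup>2 * c"
    using w_hi[of k] w_pos[of k] K \<open>0 \<le> c\<close> by (intro add_left_mono mult_right_mono power_mono) auto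
  finally show ?thesis .
qed

lemma eventually_near_limit:
  assumes sad: "(Z, T) \<in> saddle_points Lag" and lim: "x \<longlonglongrightarrow> Z" "s \<longlonglongrightarrow> T" and "0 < \<rho>"
  shows "\<exists>K. \<forall>k\<ge>K. x k \<in> ball Z \<rho> \<and> A k \<in> ball Z \<rho> \<and> s k \<in> ball T \<rho>"
proof -
  have "(\<lambda>k. A (Suc k)) \<longlonglongrightarrow> Z"
    using tendsto_diff[OF lim(1) x_minus_A_tendsto_0[OF sad]] by simp
  then have A: "A \<longlonglongrightarrow> Z" by (rule LIMSEQ_imp_Suc)
  have near: "\<forall>\<^sub>F k in sequentially. z k \<in> ball l \<rho>" if "z \<longlonglongrightarrow> l" for z :: "nat \<Rightarrow> 'a" and l
    using that \<open>0 < \<rho>\<close> by (auto simp: tendsto_iff dist_commute)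
  have "\<forall>\<^sub>F k in sequentially. x k \<in> ball Z \<rho> \<and> A k \<in> ball Z \<rho> \<and> s k \<in> ball T \<rho>"
    by (intro eventually_conj near lim A)
  then show ?thesis by (simp add: eventually_sequentially)
qed

text \<open>The gap is split at a common level \<open>val\<close> into a primal and a dual excess.
  Jensen's inequality bounds each by \<open>e / \<theta>\<close>, and the weights sum to at least
  \<open>lo * real (k - K)\<close>.\<close>

lemma ergodic_gap_le:
  assumes K: "N \<le> K" "K < k"
    and C: "\<And>T. T \<in> C \<Longrightarrow> T \<in> conj_dom \<Longrightarrow> (\<Sum>j=Suc K..k. w j * (lag (A j) T - val)) \<le> e"
    and B: "\<And>Z. Z \<in> B \<Longrightarrow> Z \<in> V \<Longrightarrow> (\<Sum>j=Suc K..k. w j * (val - lag Z (s j))) \<le> e"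
    and "0 \<le> e"
  shows "gap Lag B C (ergodic_avg w K A k) (ergodic_avg w K s k) \<le> ereal (2 * e / (lo * real (k - K)))"
proof -
  define I where "I = {Suc K..k}"
  define \<theta> where "\<theta> = (\<Sum>j\<in>I. w j)"
  define v where "v j = w j / \<theta>" for j
  have "(\<Sum>j\<in>I. lo) \<le> \<theta>"
    unfolding \<theta>_def I_def by (intro sum_mono w_lo) auto
  then have \<theta>: "lo * real (k - K) \<le> \<theta>" by (simp add: I_def mult.commute)
  have pos: "0 < lo * real (k - K)" using lo K by simp
  then have \<theta>0: "0 < \<theta>" using \<theta> by linarith
  have v0: "0 \<le> v j" if "j \<in> I" for j
    using w_pos[of j] that K \<theta>0 by (auto simp: v_def I_def)
  have v1: "(\<Sum>j\<in>I. v j) = 1"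
    using \<theta>0 by (simp add: v_def sum_divide_distrib[symmetric] \<theta>_def)
  have avg: "ergodic_avg w K z k = (\<Sum>j\<in>I. v j *\<^sub>R z j)" for z :: "nat \<Rightarrow> 'a"
    by (simp add: ergodic_avg_def v_def I_def \<theta>_def scaleR_sum_right)
  have sI: "s j \<in> conj_dom" "A j \<in> V" if "j \<in> I" for j
    using that K by (auto simp: I_def intro: s_in_conj_dom A_in_V')
  have "finite I" by (simp add: I_def)
  have up: "lag (ergodic_avg w K A k) T \<le> val + e / \<theta>" if "T \<in> C" "T \<in> conj_dom" for T
  proof -
    have "(\<Sum>j\<in>I. w j * (lag (A j) T - val)) / \<theta> = (\<Sum>j\<in>I. v j * (lag (A j) T - val))"
      by (simp add: v_def sum_divide_distrib)
    also have "\<dots> = (\<Sum>j\<in>I. v j * lag (A j) T) - val"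
      by (simp add: v1 right_diff_distrib sum_subtractf flip: sum_distrib_right)
    finally have "(\<Sum>j\<in>I. w j * (lag (A j) T - val)) / \<theta> = (\<Sum>j\<in>I. v j * lag (A j) T) - val" .
    moreover have "(\<Sum>j\<in>I. w j * (lag (A j) T - val)) / \<theta> \<le> e / \<theta>"
      using C[OF that] \<theta>0 by (intro divide_right_mono) (auto simp: I_def)
    ultimately show ?thesis
      using lag_jensen_left[OF \<open>finite I\<close> v0 v1, where Z = A and T = T] by (simp add: avg)
  qed
  have low: "val - e / \<theta> \<le> lag Z (ergodic_avg w K s k)" if "Z \<in> B" "Z \<in> V" for Z
  proof -
    have "(\<Sum>j\<in>I. w j * (val - lag Z (s j))) / \<theta> = (\<Sum>j\<in>I. v j * (val - lag Z (s j)))"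
      by (simp add: v_def sum_divide_distrib)
    also have "\<dots> = val - (\<Sum>j\<in>I. v j * lag Z (s j))"
      by (simp add: v1 right_diff_distrib sum_subtractf flip: sum_distrib_right)
    finally have "(\<Sum>j\<in>I. w j * (val - lag Z (s j))) / \<theta> = val - (\<Sum>j\<in>I. v j * lag Z (s j))" .
    moreover have "(\<Sum>j\<in>I. w j * (val - lag Z (s j))) / \<theta> \<le> e / \<theta>"
      using B[OF that] \<theta>0 by (intro divide_right_mono) (auto simp: I_def)
    ultimately show ?thesis
      using lag_jensen_right[OF \<open>finite I\<close> v0 v1, where Z = Z and T = s] sI(1) by (simp add: avg)
  qed
  have "ergodic_avg w K A k \<in> V"
    unfolding avg using V_subspace sI(2) by (intro subspace_sum subspace_scale) auto
  moreover have "ergodic_avg w K s k \<in> conj_dom"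
    unfolding avg using sI by (intro conj_jensen(1) v0 v1) (auto simp: \<open>finite I\<close>)
  ultimately have "gap Lag B C (ergodic_avg w K A k) (ergodic_avg w K s k)
      \<le> ereal ((val + e / \<theta>) - (val - e / \<theta>))"
    using up low by (rule gap_le)
  also have "(val + e / \<theta>) - (val - e / \<theta>) = 2 * e / \<theta>" by simp
  also have "2 * e / \<theta> \<le> 2 * e / (lo * real (k - K))"
    using \<open>0 \<le> e\<close> by (intro divide_left_mono[OF \<theta>] mult_pos_pos[OF \<theta>0 pos]) simp
  finally show ?thesis by simp
qed

text \<open>The comparison sets consist of the prescribed saddle point and a small ball around the limit of
  the iterates. The ergodic gap over them is of second order in the radius \<open>\<rho>\<close>: on the ball by
  \<open>gap_sum_le\<close>, and at the prescribed saddle point because its gaps have a small tail.\<close>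

theorem ergodic_rate:
  assumes sad: "(Z, T) \<in> saddle_points Lag" and lim: "x \<longlonglongrightarrow> Z" "s \<longlonglongrightarrow> T"
    and sad': "(Z', T') \<in> saddle_points Lag" and a0: "0 < a0"
  shows "\<exists>B C. \<exists>K\<ge>1. bounded (B \<times> C) \<and> (Z', T') \<in> B \<times> C \<and>
      (\<forall>k\<ge>K. (A k, s k) \<in> interior (B \<times> C)) \<and>
      (\<forall>k>K. gap Lag B C (ergodic_avg w K A k) (ergodic_avg w K s k)
        \<le> ereal (1 / real (k - K)) *
          (2 * (\<Sum>j=1..K. ereal (w j) * gap Lag B C (A j) (s j)) / ereal (2 * a0)))"
proof -
  define val where "val = lag Z T"
  have val': "lag Z' T' = val" using saddle_value_eq[OF sad sad'] by (simp add: val_def)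
  have ZV: "Z \<in> V" "T \<in> conj_dom" using sad by (auto simp: saddle_iff)
  define B where "B \<rho> = insert Z' (ball Z \<rho>)" for \<rho>
  define C where "C \<rho> = insert T' (ball T \<rho>)" for \<rho>
  have bnd: "bounded (B \<rho> \<times> C \<rho>)" and mem: "(Z', T') \<in> B \<rho> \<times> C \<rho>" for \<rho>
    by (auto simp: B_def C_def intro!: bounded_Times)
  have int: "ball Z \<rho> \<times> ball T \<rho> \<subseteq> interior (B \<rho> \<times> C \<rho>)" for \<rho>
    by (rule interior_maximal) (auto simp: B_def C_def intro: open_Times)
  define Csum where "Csum \<rho> K = (\<Sum>j=1..K. ereal (w j) * gap Lag (B \<rho>) (C \<rho>) (A j) (s j))" for \<rho> K
  have term_nonneg: "0 \<le> ereal (w j) * gap Lag (B \<rho>) (C \<rho>) (A j) (s j)" if "1 \<le> j" for \<rho> j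
    using gap_nonneg[OF sad', of "B \<rho>" "C \<rho>" "A j" "s j"] w_lo[OF that] lo
    by (auto simp: B_def C_def)
  have Csum_nonneg: "0 \<le> Csum \<rho> K" for \<rho> K
    unfolding Csum_def by (intro sum_nonneg term_nonneg) auto
  \<comment> \<open>Here the constant in the numerator pays for the rate: it suffices that
    \<open>Csum\<close> reaches \<open>2 * e * a0 / lo\<close>.\<close>
  have rate: "ereal (2 * e / (lo * real (k - K))) \<le> ereal (1 / real (k - K)) * (2 * Csum \<rho> K / ereal (2 * a0))"
    if e: "ereal (2 * e * a0 / lo) \<le> Csum \<rho> K" for e \<rho> K k
  proof -
    have "ereal (2 * (2 * e * a0 / lo) / (2 * a0)) \<le> 2 * Csum \<rho> K / ereal (2 * a0)"
    proof -
      have "2 * ereal (2 * e * a0 / lo) \<le> 2 * Csum \<rho> K"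
        using e by (intro ereal_mult_left_mono) auto
      then have "2 * ereal (2 * e * a0 / lo) / ereal (2 * a0) \<le> 2 * Csum \<rho> K / ereal (2 * a0)"
        using a0 by (intro ereal_divide_right_mono) auto
      then show ?thesis using a0 by simp
    qed
    then have "ereal (1 / real (k - K)) * ereal (2 * (2 * e * a0 / lo) / (2 * a0))
        \<le> ereal (1 / real (k - K)) * (2 * Csum \<rho> K / ereal (2 * a0))"
      by (intro ereal_mult_left_mono) auto
    then show ?thesis using a0 by (simp add: field_simps)
  qed
  show ?thesis
  \<comment> \<open>Either every late pair is a saddle point with value \<open>val\<close>, and the
    claim holds with \<open>e = 0\<close> and radius 1, or some late pair has a gap at least linear
    in the radius.\<close>
  proof (cases "\<forall>j>N. (A j, s j) \<in> saddle_points Lag")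
    case True
    obtain K1 where K1: "\<forall>k\<ge>K1. x k \<in> ball Z 1 \<and> A k \<in> ball Z 1 \<and> s k \<in> ball T 1"
      using eventually_near_limit[OF sad lim, of 1] by auto
    define K where "K = max N K1"
    have "gap Lag (B 1) (C 1) (ergodic_avg w K A k) (ergodic_avg w K s k)
        \<le> ereal (1 / real (k - K)) * (2 * Csum 1 K / ereal (2 * a0))" if k: "K < k" for k
    proof -
      have "gap Lag (B 1) (C 1) (ergodic_avg w K A k) (ergodic_avg w K s k) \<le> ereal (2 * 0 / (lo * real (k - K)))"
      proof (rule ergodic_gap_le[where val = val])
        fix T2 assume T2: "T2 \<in> conj_dom"
        have "w j * (lag (A j) T2 - val) \<le> 0" if j: "j \<in> {Suc K..k}" for j
        proof -
          have "N < j" using j max.cobounded1[of N K1] unfolding K_def atLeastAtMost_iff by linarith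
          then have sj: "(A j, s j) \<in> saddle_points Lag" using True by blast
          then have "lag (A j) T2 \<le> lag (A j) (s j)" using T2 by (simp add: saddle_iff)
          also have "\<dots> = val" using saddle_value_eq[OF sj sad] by (simp add: val_def)
          finally show ?thesis
            using w_pos[of j] \<open>N < j\<close> by (intro mult_nonneg_nonpos) auto
        qed
        then show "(\<Sum>j=Suc K..k. w j * (lag (A j) T2 - val)) \<le> 0" by (rule sum_nonpos)
      next
        fix Z2 assume Z2: "Z2 \<in> V"
        have "w j * (val - lag Z2 (s j)) \<le> 0" if j: "j \<in> {Suc K..k}" for j
        proof -
          have "N < j" using j max.cobounded1[of N K1] unfolding K_def atLeastAtMost_iff by linarith
          then have sj: "(A j, s j) \<in> saddle_points Lag" using True by blast
          then have "lag (A j) (s j) \<le> lag Z2 (s j)" using Z2 by (simp add: saddle_iff)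
          moreover have "lag (A j) (s j) = val" using saddle_value_eq[OF sj sad] by (simp add: val_def)
          ultimately show ?thesis
            using w_pos[of j] \<open>N < j\<close> by (intro mult_nonneg_nonpos) auto
        qed
        then show "(\<Sum>j=Suc K..k. w j * (val - lag Z2 (s j))) \<le> 0" by (rule sum_nonpos)
      qed (use k in \<open>auto simp: K_def\<close>)
      also have "\<dots> \<le> ereal (1 / real (k - K)) * (2 * Csum 1 K / ereal (2 * a0))"
        using Csum_nonneg[of 1 K] by (intro rate) (simp flip: zero_ereal_def)
      finally show ?thesis .
    qed
    moreover have "(A k, s k) \<in> interior (B 1 \<times> C 1)" if "K \<le> k" for k
      using K1 that int[of 1] by (auto simp: K_def)
    moreover have "1 \<le> K" using N1 by (simp add: K_def)
    ultimately show ?thesis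
      using bnd[of 1] mem[of 1] unfolding Csum_def by blast
  next
    case False
    then obtain t0 where t0: "N < t0" "(A t0, s t0) \<notin> saddle_points Lag" by blast
    \<comment> \<open>\<open>c\<close> depends neither on the radius nor on the sets, so
      \<open>\<rho>\<close> may be chosen after it.\<close>
    obtain c where c: "0 < c" and low: "\<And>\<rho> B C. 0 < \<rho> \<Longrightarrow> \<rho> \<le> 1 \<Longrightarrow> ball Z \<rho> \<subseteq> B \<Longrightarrow> ball T \<rho> \<subseteq> C \<Longrightarrow>
           ereal (c * \<rho>) \<le> gap Lag B C (A t0) (s t0)"
      using gap_ball_linear_lower_bound[OF sad A_in_V' s_in_conj_dom t0(2)] t0(1) by metis
    \<comment> \<open>\<open>c1 * \<rho>\<^sup>2\<close> covers half of
      \<open>\<rho>\<^sup>2 + hi\<^sup>2 * (2 * \<rho>)\<^sup>2\<close>, from dual comparison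
      points, and half of \<open>(2 * \<rho>)\<^sup>2 + hi\<^sup>2 * \<rho>\<^sup>2\<close>, from
      primal ones.\<close>
    define c1 where "c1 = 2 + 2 * hi\<^sup>2"
    have c1: "0 < c1" using zero_le_power2[of hi] unfolding c1_def by linarith
    \<comment> \<open>Small enough that the second-order quantity \<open>2 * e * a0 / lo\<close> is
      at most the first-order contribution \<open>lo * (c * \<rho>)\<close> of the index
      \<open>t0\<close>.\<close>
    define \<rho> where "\<rho> = min 1 (lo\<^sup>2 * c / (2 * c1 * a0))"
    have \<rho>: "0 < \<rho>" "\<rho> \<le> 1" "\<rho> \<le> lo\<^sup>2 * c / (2 * c1 * a0)"
      using lo c c1 a0 by (auto simp: \<rho>_def)
    define e where "e = c1 * \<rho>\<^sup>2"
    have e: "0 < e" using c1 \<rho> by (simp add: e_def)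
    obtain K1 where K1: "\<forall>k\<ge>K1. x k \<in> ball Z \<rho> \<and> A k \<in> ball Z \<rho> \<and> s k \<in> ball T \<rho>"
      using eventually_near_limit[OF sad lim \<rho>(1)] by auto
    obtain K0 where K0: "\<And>K k. K0 \<le> K \<Longrightarrow> K \<le> k \<Longrightarrow> (\<Sum>j=Suc K..k. w j * (lag (A j) T' - lag Z' (s j))) \<le> e"
      using saddle_gap_tail[OF sad' e] by blast
    \<comment> \<open>\<open>t0\<close> puts the nonvanishing gap into \<open>Csum\<close>,
      \<open>K1\<close> brings the iterates into the balls of radius \<open>\<rho>\<close>, and
      \<open>K0\<close> pushes the tail at the prescribed saddle point below
      \<open>e\<close>.\<close>
    define K where "K = Max {K0, K1, t0, N}"
    have K: "K0 \<le> K" "K1 \<le> K" "t0 \<le> K" "N \<le> K" by (auto simp: K_def)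
    have \<rho>2: "0 \<le> \<rho>\<^sup>2" "0 \<le> hi\<^sup>2 * \<rho>\<^sup>2" by auto
    have sum_le: "(\<Sum>j=Suc K..k. w j * p j) \<le> (\<Sum>j=Suc K..k. w j * q j)"
      if "\<And>j. N < j \<Longrightarrow> p j \<le> q j" for p q :: "nat \<Rightarrow> real" and k
    proof (intro sum_mono mult_left_mono)
      fix j assume "j \<in> {Suc K..k}"
      then have "N < j" using K by simp
      then show "p j \<le> q j" "0 \<le> w j" using that w_pos[of j] by auto
    qed
    have "gap Lag (B \<rho>) (C \<rho>) (ergodic_avg w K A k) (ergodic_avg w K s k)
        \<le> ereal (1 / real (k - K)) * (2 * Csum \<rho> K / ereal (2 * a0))" if k: "K < k" for k
    proof -
      have "gap Lag (B \<rho>) (C \<rho>) (ergodic_avg w K A k) (ergodic_avg w K s k) \<le> ereal (2 * e / (lo * real (k - K)))"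
      proof (rule ergodic_gap_le[where val = val])
        fix T2 assume T2: "T2 \<in> C \<rho>" "T2 \<in> conj_dom"
        show "(\<Sum>j=Suc K..k. w j * (lag (A j) T2 - val)) \<le> e"
        proof (cases "T2 = T'")
          case True
          \<comment> \<open>\<open>val\<close> is also the value at the prescribed saddle point;
            lowering it to \<open>lag Z' (s j)\<close> only increases the terms, and the tail
            estimate applies.\<close>
          have "(\<Sum>j=Suc K..k. w j * (lag (A j) T2 - val)) \<le> (\<Sum>j=Suc K..k. w j * (lag (A j) T' - lag Z' (s j)))"
            using sad' s_in_conj_dom val' True by (intro sum_le) (auto simp: saddle_iff)
          then show ?thesis using K0[OF K(1), of k] k by simp
        next
          case False
          then have T2\<rho>: "dist T T2 < \<rho>" using T2 by (auto simp: C_def)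
          have "(\<Sum>j=Suc K..k. w j * (lag (A j) T2 - val)) \<le> (\<Sum>j=Suc K..k. w j * (lag (A j) T2 - lag Z (s j)))"
            using sad s_in_conj_dom by (intro sum_le) (auto simp: saddle_iff val_def)
          moreover have "2 * (\<Sum>j=Suc K..k. w j * (lag (A j) T2 - lag Z (s j))) \<le> (norm (x K - Z))\<^sup>2 + hi\<^sup>2 * (2 * \<rho>)\<^sup>2"
          proof (rule gap_sum_le[OF ZV(1) T2(2) K(4)])
            fix j assume "K \<le> j"
            then have "dist T (s j) < \<rho>" using K1 K(2) by auto
            then have "norm (s j - T2) \<le> 2 * \<rho>"
              using dist_triangle[of "s j" T2 T] T2\<rho> by (simp add: dist_norm norm_minus_commute)
            then show "(norm (s j - T2))\<^sup>2 \<le> (2 * \<rho>)\<^sup>2" by (intro power_mono) auto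
          qed (use k in simp)
          moreover have "(norm (x K - Z))\<^sup>2 \<le> \<rho>\<^sup>2"
            using K1 K(2) by (intro power_mono) (auto simp: dist_norm norm_minus_commute less_imp_le)
          ultimately show ?thesis unfolding e_def c1_def
            by (simp add: distrib_right power_mult_distrib) (use \<rho>2 in linarith)
        qed
      next
        fix Z2 assume Z2: "Z2 \<in> B \<rho>" "Z2 \<in> V"
        show "(\<Sum>j=Suc K..k. w j * (val - lag Z2 (s j))) \<le> e"
        proof (cases "Z2 = Z'")
          case True
          have "(\<Sum>j=Suc K..k. w j * (val - lag Z2 (s j))) \<le> (\<Sum>j=Suc K..k. w j * (lag (A j) T' - lag Z' (s j)))"
            using sad' A_in_V' val' True by (intro sum_le) (auto simp: saddle_iff)
          then show ?thesis using K0[OF K(1), of k] k by simp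
        next
          case False
          then have Z2\<rho>: "dist Z Z2 < \<rho>" using Z2 by (auto simp: B_def)
          have "(\<Sum>j=Suc K..k. w j * (val - lag Z2 (s j))) \<le> (\<Sum>j=Suc K..k. w j * (lag (A j) T - lag Z2 (s j)))"
            using sad A_in_V' by (intro sum_le) (auto simp: saddle_iff val_def)
          moreover have "2 * (\<Sum>j=Suc K..k. w j * (lag (A j) T - lag Z2 (s j))) \<le> (norm (x K - Z2))\<^sup>2 + hi\<^sup>2 * \<rho>\<^sup>2"
          proof (rule gap_sum_le[OF Z2(2) ZV(2) K(4)])
            fix j assume "K \<le> j"
            then have "dist T (s j) < \<rho>" using K1 K(2) by auto
            then show "(norm (s j - T))\<^sup>2 \<le> \<rho>\<^sup>2"
              by (intro power_mono) (auto simp: dist_norm norm_minus_commute)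
          qed (use k in simp)
          moreover have "(norm (x K - Z2))\<^sup>2 \<le> (2 * \<rho>)\<^sup>2"
          proof -
            have "dist Z (x K) < \<rho>" using K1 K(2) by auto
            then have "norm (x K - Z2) \<le> 2 * \<rho>"
              using dist_triangle[of "x K" Z2 Z] Z2\<rho> by (simp add: dist_norm norm_minus_commute)
            then show ?thesis by (intro power_mono) auto
          qed
          ultimately show ?thesis unfolding e_def c1_def
            by (simp add: distrib_right power_mult_distrib) (use \<rho>2 in linarith)
        qed
      qed (use k K e in auto)
      also have "\<dots> \<le> ereal (1 / real (k - K)) * (2 * Csum \<rho> K / ereal (2 * a0))"
      proof (rule rate)
        have "2 * c1 * a0 * \<rho> \<le> lo\<^sup>2 * c" using \<rho>(3) c1 a0 by (simp add: pos_le_divide_eq mult_ac)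
        then have "(2 * c1 * a0 * \<rho>) * \<rho> \<le> (lo\<^sup>2 * c) * \<rho>" using \<rho> by (intro mult_right_mono) auto
        then have "2 * e * a0 / lo \<le> lo * (c * \<rho>)"
          using lo by (simp add: e_def pos_divide_le_eq power2_eq_square mult_ac)
        then have "ereal (2 * e * a0 / lo) \<le> ereal lo * ereal (c * \<rho>)" by simp
        also have "\<dots> \<le> ereal (w t0) * gap Lag (B \<rho>) (C \<rho>) (A t0) (s t0)"
          using low[OF \<rho>(1,2), of "B \<rho>" "C \<rho>"] w_lo[of t0] t0 lo c \<rho>
          by (intro ereal_mult_mono) (auto simp: B_def C_def)
        also have "\<dots> = (\<Sum>j\<in>{t0}. ereal (w j) * gap Lag (B \<rho>) (C \<rho>) (A j) (s j))" by simp
        also have "\<dots> \<le> Csum \<rho> K"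
          unfolding Csum_def using t0 K by (intro sum_mono2 term_nonneg) auto
        finally show "ereal (2 * e * a0 / lo) \<le> Csum \<rho> K" .
      qed
      finally show ?thesis .
    qed
    moreover have "(A k, s k) \<in> interior (B \<rho> \<times> C \<rho>)" if "K \<le> k" for k
      using K1 K that int[of \<rho>] by auto
    moreover have "1 \<le> K" using N1 K by simp
    ultimately show ?thesis
      using bnd[of \<rho>] mem[of \<rho>] unfolding Csum_def by blast
  qed
qed

end

subsection \<open>Stepsizes\<close>

text \<open>\<open>j k l\<close> is the number of reductions that agent \<open>l\<close> makes in
  iteration \<open>k\<close>. First these counts vanish; afterwards values of \<open>p\<close> are
  only copied between neighbours, and the minimum reaches everyone in finitely many
  iterations.\<close>

lemma consensus_stepsizes:
  fixes a :: "nat \<Rightarrow> 'm::finite \<Rightarrow> real" and j :: "nat \<Rightarrow> 'm \<Rightarrow> nat"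
  assumes graph: "connected_graph E" and \<eta>: "0 < \<eta>" "\<eta> < 1"
    and \<mu>: "\<And>k. 0 \<le> \<mu> k" "summable \<mu>"
    and lo: "0 < lo" "\<And>k i. lo \<le> a (Suc k) i" and a0: "\<And>i. 0 < a 0 i"
    and step: "\<And>k i. a (Suc k) i = Min ((\<lambda>l. \<eta> ^ j k l * sqrt ((a k l)\<^sup>2 + \<mu> k)) ` nbhd E i)"
  shows "\<exists>N\<ge>1. \<forall>k\<ge>N. \<forall>i. j k i = 0 \<and> (\<forall>l. a k i = a k l)"
proof -
  define b where "b k l = \<eta> ^ j k l * sqrt ((a k l)\<^sup>2 + \<mu> k)" for k l
  define p where "p k i = (a k i)\<^sup>2 - (\<Sum>t<k. \<mu> t)" for k i
  have apos: "0 < a k i" for k i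
    using a0 lo(1) lo(2)[of _ i] by (cases k) (auto intro: less_le_trans)
  have nbhd: "finite (nbhd E i)" "i \<in> nbhd E i" for i
    by (auto simp: nbhd_def)
  have Suc_le_b: "a (Suc k) i \<le> b k l" if "l \<in> nbhd E i" for k i l
    unfolding step b_def using that nbhd by (intro Min_le) auto
  have sq: "(sqrt ((a k l)\<^sup>2 + \<mu> k))\<^sup>2 = (a k l)\<^sup>2 + \<mu> k" for k l
    using \<mu>(1)[of k] by simp
  have p_Suc_le: "p (Suc k) i \<le> p k l" if "l \<in> nbhd E i" for k i l
  proof -
    have "b k l \<le> 1 * sqrt ((a k l)\<^sup>2 + \<mu> k)"
      unfolding b_def using \<eta> \<mu>(1)[of k] by (intro mult_right_mono power_le_one) auto
    then have "a (Suc k) i \<le> sqrt ((a k l)\<^sup>2 + \<mu> k)" using Suc_le_b[OF that, of k] by simp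
    then have "(a (Suc k) i)\<^sup>2 \<le> (sqrt ((a k l)\<^sup>2 + \<mu> k))\<^sup>2"
      using apos[of "Suc k" i] by (intro power_mono) auto
    then show ?thesis by (simp add: p_def sq)
  qed
  have p_anti: "p m i \<le> p k i" if "k \<le> m" for k m i
    using that by (induction m rule: dec_induct) (auto intro: order_trans p_Suc_le nbhd)
  \<comment> \<open>A reduction lowers \<open>p\<close> by at least
    \<open>(1 - \<eta>\<^sup>2) * lo\<^sup>2\<close>, whereas the decrements of a convergent
    sequence tend to 0. The bound \<open>lo\<close> holds from index 1 on, hence the restriction to
    \<open>1 \<le> k\<close>.\<close>
  have no_backtrack: "\<forall>\<^sub>F k in sequentially. j k i = 0" for i
  proof -
    have "decseq (\<lambda>k. p k i)" unfolding decseq_def using p_anti by blast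
    moreover have "- suminf \<mu> \<le> p k i" for k
      proof -
      have "sum \<mu> {..<k} \<le> suminf \<mu>" using \<mu> by (intro sum_le_suminf) auto
      then show ?thesis using zero_le_power2[of "a k i"] unfolding p_def by linarith
    qed
    ultimately obtain l where l: "(\<lambda>k. p k i) \<longlonglongrightarrow> l"
      using decseq_convergent by metis
    have "(\<lambda>k. p k i - p (Suc k) i) \<longlonglongrightarrow> l - l"
      by (intro tendsto_diff l LIMSEQ_Suc)
    moreover have pos: "0 < (1 - \<eta>\<^sup>2) * lo\<^sup>2"
      using \<eta> lo by (simp add: power_less_one_iff)
    ultimately have "\<forall>\<^sub>F k in sequentially. p k i - p (Suc k) i < (1 - \<eta>\<^sup>2) * lo\<^sup>2"
      by (intro order_tendstoD) auto
    moreover have "\<forall>\<^sub>F k in sequentially. 1 \<le> k" by (rule eventually_ge_at_top)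
    ultimately show ?thesis
    proof eventually_elim
      case (elim k)
      show ?case
      proof (rule ccontr)
        assume "j k i \<noteq> 0"
        then have "\<eta> ^ j k i \<le> \<eta> ^ 1" using \<eta> by (intro power_decreasing) auto
        then have "b k i \<le> \<eta> * sqrt ((a k i)\<^sup>2 + \<mu> k)"
          unfolding b_def using \<mu>(1)[of k] by (intro mult_right_mono) auto
        then have "a (Suc k) i \<le> \<eta> * sqrt ((a k i)\<^sup>2 + \<mu> k)"
          using Suc_le_b[OF nbhd(2), of k i] by simp
        then have "(a (Suc k) i)\<^sup>2 \<le> (\<eta> * sqrt ((a k i)\<^sup>2 + \<mu> k))\<^sup>2"
          using apos[of "Suc k" i] by (intro power_mono) auto
        also have "\<dots> = \<eta>\<^sup>2 * ((a k i)\<^sup>2 + \<mu> k)" by (simp add: power_mult_distrib sq)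
        finally have "(1 - \<eta>\<^sup>2) * ((a k i)\<^sup>2 + \<mu> k) \<le> p k i - p (Suc k) i"
          by (simp add: p_def algebra_simps)
        moreover have "(1 - \<eta>\<^sup>2) * lo\<^sup>2 \<le> (1 - \<eta>\<^sup>2) * ((a k i)\<^sup>2 + \<mu> k)"
        proof (rule mult_left_mono)
          have "lo \<le> a k i" using lo(2)[of "k - 1" i] elim by simp
          then have "lo\<^sup>2 \<le> (a k i)\<^sup>2" using lo by (intro power_mono) auto
          then show "lo\<^sup>2 \<le> (a k i)\<^sup>2 + \<mu> k" using \<mu>(1)[of k] by simp
          show "0 \<le> 1 - \<eta>\<^sup>2" using \<eta> by (simp add: power_le_one)
        qed
        ultimately show False using elim by simp
      qed
    qed
  qed
  then have "\<forall>\<^sub>F k in sequentially. \<forall>i. j k i = 0" by (rule eventually_all_finite)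
  then obtain N0 where N0: "\<And>k i. N0 \<le> k \<Longrightarrow> j k i = 0" by (auto simp: eventually_sequentially)
  \<comment> \<open>Without reductions each new value of \<open>p\<close> is an old value of some
    neighbour, so the minimum at \<open>N0\<close> stays a lower bound.\<close>
  define m0 where "m0 = Min (range (p N0))"
  have m0_le: "m0 \<le> p k i" if "N0 \<le> k" for k i
    using that
  proof (induction k arbitrary: i rule: dec_induct)
    case base
    then show ?case by (simp add: m0_def)
  next
    case (step k)
    have "a (Suc k) i \<in> (\<lambda>l. sqrt ((a k l)\<^sup>2 + \<mu> k)) ` nbhd E i"
    proof -
      have "(\<lambda>l. \<eta> ^ j k l * sqrt ((a k l)\<^sup>2 + \<mu> k)) ` nbhd E i = (\<lambda>l. sqrt ((a k l)\<^sup>2 + \<mu> k)) ` nbhd E i"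
        using N0[OF step(1)] by simp
      moreover have "nbhd E i \<noteq> {}" using nbhd(2) by blast
      ultimately show ?thesis unfolding assms(9) using nbhd(1)[of i] by (simp only:) (rule Min_in, auto)
    qed
    then obtain l where "a (Suc k) i = sqrt ((a k l)\<^sup>2 + \<mu> k)" by blast
    then have "p (Suc k) i = p k l" by (simp add: p_def sq)
    then show ?case using step by simp
  qed
  have "m0 \<in> range (p N0)" unfolding m0_def by (rule Min_in) auto
  \<comment> \<open>Agent \<open>i0\<close> attains the minimum. Induction along a path from
    \<open>i0\<close> to \<open>i\<close> shows that each edge passes the upper bound
    \<open>m0\<close> on, one iteration later.\<close>
  then obtain i0 where i0: "p N0 i0 = m0" by blast
  have "\<forall>\<^sub>F k in sequentially. p k i \<le> m0" for i
  proof -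
    have "(i0, i) \<in> E\<^sup>*" using graph by (simp add: connected_graph_def)
    then show ?thesis
    proof induction
      case base
      then show ?case using p_anti[of N0 _ i0] i0 by (auto simp: eventually_sequentially)
    next
      case (step y z)
      then have "y \<in> nbhd E z" using graph by (auto simp: nbhd_def connected_graph_def dest: symD)
      then have "\<forall>\<^sub>F k in sequentially. p (Suc k) z \<le> m0"
        using step.IH p_Suc_le by (auto elim!: eventually_mono intro: order_trans)
      then show ?case by (simp add: eventually_sequentially_Suc[of "\<lambda>k. p k z \<le> m0"])
    qed
  qed
  then have "\<forall>\<^sub>F k in sequentially. \<forall>i. p k i \<le> m0" by (rule eventually_all_finite)
  then obtain N1 where N1: "\<And>k i. N1 \<le> k \<Longrightarrow> p k i \<le> m0" by (auto simp: eventually_sequentially)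
  have "a k i = a k l" if k: "max N0 N1 \<le> k" for k i l
  proof -
    have "p k i = p k l" using m0_le[of k i] m0_le[of k l] N1[of k i] N1[of k l] k by simp
    then have "(a k i)\<^sup>2 = (a k l)\<^sup>2" by (simp add: p_def)
    then show ?thesis using apos[of k i] apos[of k l] by (simp add: power2_eq_iff_nonneg)
  qed
  then show ?thesis
    using N0 by (intro exI[of _ "max 1 (max N0 N1)"]) (auto simp del: split_paired_All)
qed

subsection \<open>The lifted algorithm\<close>

lemma linear_matrix_mult_left: "linear (\<lambda>X::real^'d^'m. (B::real^'m^'m) ** X)"
  by (rule linearI) (simp_all add: vec_eq_iff matrix_matrix_mult_def sum.distrib
      distrib_left sum_distrib_left mult_ac)

lemmas matrix_mult_add = linear_add[OF linear_matrix_mult_left]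
  and matrix_mult_diff = linear_diff[OF linear_matrix_mult_left]
  and matrix_mult_scale = linear_scale[OF linear_matrix_mult_left]
  and matrix_mult_zero = linear_0[OF linear_matrix_mult_left]

lemma matrix_diff_mult: "(B - C) ** X = B ** X - C ** (X::real^'d^'m)" for B C :: "real^'m^'m"
  by (simp add: vec_eq_iff matrix_matrix_mult_def left_diff_distrib sum_subtractf)

lemma diag_mat_mult_row: "(diag_mat b ** X) $ i = b i *\<^sub>R (X $ i)" for X :: "real^'d^'m::finite"
  by (simp add: vec_eq_iff matrix_matrix_mult_def diag_mat_def if_distrib[of "\<lambda>t. t * _"] cong: if_cong)

lemma inner_symmetric_mult:
  fixes B :: "real^'m^'m::finite" and X Z :: "real^'d^'m"
  assumes "transpose B = B"
  shows "(B ** X) \<bullet> Z = X \<bullet> (B ** Z)"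
proof -
  have B: "B $ i $ k = B $ k $ i" for i k
  proof -
    have "transpose B $ i $ k = B $ i $ k" by (simp only: assms)
    then show ?thesis by (simp add: transpose_def)
  qed
  have "(B ** X) \<bullet> Z = (\<Sum>i\<in>UNIV. \<Sum>d\<in>UNIV. \<Sum>k\<in>UNIV. B $ i $ k * X $ k $ d * Z $ i $ d)"
    by (simp add: inner_vec_def matrix_matrix_mult_def sum_distrib_right)
  also have "\<dots> = (\<Sum>i\<in>UNIV. \<Sum>k\<in>UNIV. \<Sum>d\<in>UNIV. B $ i $ k * X $ k $ d * Z $ i $ d)"
    by (intro sum.cong refl sum.swap)
  also have "\<dots> = (\<Sum>k\<in>UNIV. \<Sum>i\<in>UNIV. \<Sum>d\<in>UNIV. B $ i $ k * X $ k $ d * Z $ i $ d)"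
    by (rule sum.swap)
  also have "\<dots> = (\<Sum>k\<in>UNIV. \<Sum>d\<in>UNIV. \<Sum>i\<in>UNIV. B $ i $ k * X $ k $ d * Z $ i $ d)"
    by (intro sum.cong refl sum.swap)
  also have "\<dots> = X \<bullet> (B ** Z)"
    by (simp add: inner_vec_def matrix_matrix_mult_def sum_distrib_left B mult_ac)
  finally show ?thesis .
qed

text \<open>With a common stepsize \<open>\<alpha>\<close> the lifted step is the projection of a gradient step onto the
  kernel of \<open>[Q M]\<close>; the normal component is \<open>\<alpha> [Q M]\<^sup>T Y'\<close>.\<close>

lemma lifted_projection_step:
  fixes Q M W :: "real^'m^'m::finite" and X S D Y Y' A G :: "real^'d^'m"
  assumes Q: "psd_root Q (mat 1 - W)" and M: "psd_root M W" and \<alpha>: "\<alpha> \<noteq> 0"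
    and D: "D = Q ** Y" and Y': "Y' = Y + Q ** ((1 / \<alpha>) *\<^sub>R X - S - D - G)"
    and A: "A = W ** X - \<alpha> *\<^sub>R (W ** (G + S + D))"
  shows "Q ** A + M ** (\<alpha> *\<^sub>R (M ** (Y - Y'))) = 0"
    and "Q ** Z + M ** Z' = 0 \<Longrightarrow>
      (X - \<alpha> *\<^sub>R (G + S) - A) \<bullet> Z + (\<alpha> *\<^sub>R (M ** Y) - \<alpha> *\<^sub>R (M ** (Y - Y'))) \<bullet> Z' = 0"
proof -
  note mm = matrix_mult_add matrix_mult_diff matrix_mult_scale
  have QQ: "Q ** (Q ** U) = U - W ** U" for U :: "real^'d^'m"
    using Q by (simp add: psd_root_def matrix_mul_assoc matrix_diff_mult)
  have MM: "M ** (M ** U) = W ** U" for U :: "real^'d^'m"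
    using M by (simp add: psd_root_def matrix_mul_assoc)
  \<comment> \<open>\<open>W\<close> is the identity minus the square of \<open>Q\<close>, so the
    two commute. This makes the two blocks cancel in the feasibility equation.\<close>
  have comm: "Q ** (W ** U) = W ** (Q ** U)" for U :: "real^'d^'m"
    using QQ[of "Q ** U"] arg_cong[OF QQ[of U], of "\<lambda>T. Q ** T"] by (simp add: mm)
  show "Q ** A + M ** (\<alpha> *\<^sub>R (M ** (Y - Y'))) = 0"
    using \<alpha> by (simp add: A Y' mm MM comm algebra_simps)
  assume Z: "Q ** Z + M ** Z' = 0"
  have sym: "transpose Q = Q" "transpose M = M"
    using Q M by (auto simp: psd_root_def psd_def)
  have "X - \<alpha> *\<^sub>R (G + S) - A = \<alpha> *\<^sub>R (Q ** Y')"
    using \<alpha> by (simp add: A Y' D mm QQ comm algebra_simps)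
  moreover have "\<alpha> *\<^sub>R (M ** Y) - \<alpha> *\<^sub>R (M ** (Y - Y')) = \<alpha> *\<^sub>R (M ** Y')"
    by (simp add: mm algebra_simps)
  ultimately have "(X - \<alpha> *\<^sub>R (G + S) - A) \<bullet> Z + (\<alpha> *\<^sub>R (M ** Y) - \<alpha> *\<^sub>R (M ** (Y - Y'))) \<bullet> Z'
      = \<alpha> * (Y' \<bullet> (Q ** Z + M ** Z'))"
    by (simp add: inner_symmetric_mult[OF sym(1)] inner_symmetric_mult[OF sym(2)] inner_add_right distrib_left)
  then show "(X - \<alpha> *\<^sub>R (G + S) - A) \<bullet> Z + (\<alpha> *\<^sub>R (M ** Y) - \<alpha> *\<^sub>R (M ** (Y - Y'))) \<bullet> Z' = 0"
    by (simp add: Z)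
qed

section \<open>Row-wise structure of the lifted functions\<close>

lemma R_sum_ninf:
  fixes r :: "'m::finite \<Rightarrow> real^'d::finite \<Rightarrow> ereal"
  assumes "\<And>i z. r i z \<noteq> -\<infinity>"
  shows "R_sum r X \<noteq> -\<infinity>"
proof -
  have "sum h I \<noteq> -\<infinity>" if "finite I" "\<And>i. h i \<noteq> -\<infinity>" for I and h :: "'m \<Rightarrow> ereal"
    using that(1) by induction (use that(2) in auto)
  from this[of UNIV] show ?thesis using assms by (simp add: R_sum_def)
qed

text \<open>The sum is separable over the rows, and the indicator of 0 forces the second block of
  \<open>Z\<close> to vanish while leaving that of \<open>T\<close> free. To isolate row
  \<open>i\<close>, only this row is varied, and the finite values of the others cancel.\<close>

lemma subgrad_R_lift_iff:
  fixes r :: "'m::finite \<Rightarrow> real^'d::finite \<Rightarrow> ereal"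
  assumes ninf: "\<And>i z. r i z \<noteq> -\<infinity>"
  shows "subgrad (R_lift r) Z T \<longleftrightarrow> snd Z = 0 \<and> (\<forall>i. subgrad (r i) (fst Z $ i) (fst T $ i))"
proof (intro iffI conjI allI)
  assume sub: "subgrad (R_lift r) Z T"
  then have fin: "\<bar>R_lift r Z\<bar> \<noteq> \<infinity>" by (simp add: subgrad_def)
  then show snd0: "snd Z = 0" by (auto simp: R_lift_def ind0_def split: if_splits)
  then have RS: "R_lift r Z = R_sum r (fst Z)" by (simp add: R_lift_def ind0_def)
  have fin_rows: "\<bar>r i (fst Z $ i)\<bar> \<noteq> \<infinity>" for i
    using fin unfolding RS R_sum_def sum_Inf by simp
  have "\<exists>\<rho>. r i (fst Z $ i) = ereal \<rho>" for i
    using fin_rows[of i] by (cases "r i (fst Z $ i)") auto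
  then obtain \<rho> where \<rho>: "\<And>i. r i (fst Z $ i) = ereal (\<rho> i)"
    by metis
  fix i
  have "r i (fst Z $ i) + ereal (fst T $ i \<bullet> (y - fst Z $ i)) \<le> r i y" for y
  proof -
    define X' where "X' = (\<chi> l. if l = i then y else fst Z $ l)"
    have "fst T \<bullet> (X' - fst Z) = (\<Sum>l\<in>UNIV. if l = i then fst T $ i \<bullet> (y - fst Z $ i) else 0)"
      unfolding inner_vec_def[of "fst T"] by (intro sum.cong) (auto simp: X'_def)
    then have ip: "T \<bullet> ((X', 0) - Z) = fst T $ i \<bullet> (y - fst Z $ i)"
      using snd0 by (simp add: inner_prod_def)
    have "R_lift r Z + ereal (T \<bullet> ((X', 0) - Z)) \<le> R_lift r (X', 0)"
      using sub by (simp add: subgrad_def)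
    then have "R_sum r (fst Z) + ereal (fst T $ i \<bullet> (y - fst Z $ i)) \<le> R_sum r X'"
      by (simp only: ip RS) (simp add: R_lift_def ind0_def)
    moreover have "R_sum r X' = r i y + (\<Sum>l\<in>UNIV - {i}. r l (X' $ l))"
      unfolding R_sum_def by (subst sum.remove[of UNIV i]) (auto simp: X'_def)
    moreover have "(\<Sum>l\<in>UNIV - {i}. r l (X' $ l)) = ereal (\<Sum>l\<in>UNIV - {i}. \<rho> l)"
      by (simp add: X'_def \<rho>)
    moreover have "R_sum r (fst Z) = ereal (\<rho> i + (\<Sum>l\<in>UNIV - {i}. \<rho> l))"
      using sum.remove[of UNIV i \<rho>] by (simp add: R_sum_def \<rho>)
    ultimately show ?thesis
      by (cases "r i y") (auto simp: \<rho>)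
  qed
  then show "subgrad (r i) (fst Z $ i) (fst T $ i)" by (simp add: subgrad_def \<rho>)
next
  assume *: "snd Z = 0 \<and> (\<forall>i. subgrad (r i) (fst Z $ i) (fst T $ i))"
  then have fin_rows: "\<bar>r i (fst Z $ i)\<bar> \<noteq> \<infinity>" for i by (auto simp: subgrad_def)
  have "\<exists>\<rho>. r i (fst Z $ i) = ereal \<rho>" for i
    using fin_rows[of i] by (cases "r i (fst Z $ i)") auto
  then obtain \<rho> where \<rho>: "\<And>i. r i (fst Z $ i) = ereal (\<rho> i)"
    by metis
  have RZ: "R_lift r Z = ereal (\<Sum>i\<in>UNIV. \<rho> i)"
    using * by (simp add: R_lift_def ind0_def R_sum_def \<rho>)
  have "R_lift r Z + ereal (T \<bullet> (y - Z)) \<le> R_lift r y" for y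
  proof (cases "snd y = 0")
    case True
    have "T \<bullet> (y - Z) = (\<Sum>i\<in>UNIV. fst T $ i \<bullet> (fst y $ i - fst Z $ i))"
      using True * by (simp add: inner_prod_def inner_vec_def[of "fst T"])
    then have "R_lift r Z + ereal (T \<bullet> (y - Z)) = (\<Sum>i\<in>UNIV. r i (fst Z $ i) + ereal (fst T $ i \<bullet> (fst y $ i - fst Z $ i)))"
      by (simp add: RZ \<rho> sum.distrib)
    also have "\<dots> \<le> (\<Sum>i\<in>UNIV. r i (fst y $ i))"
      using * by (intro sum_mono) (auto simp: subgrad_def)
    also have "\<dots> = R_lift r y" using True by (simp add: R_lift_def ind0_def R_sum_def)
    finally show ?thesis .
  next
    case False
    then show ?thesis using R_sum_ninf[of r "fst y", OF ninf] by (simp add: R_lift_def ind0_def)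
  qed
  then show "subgrad (R_lift r) Z T" by (simp add: subgrad_def RZ)
qed

lemma R_lift_ninf:
  fixes r :: "'m::finite \<Rightarrow> real^'d::finite \<Rightarrow> ereal"
  assumes "\<And>i z. r i z \<noteq> -\<infinity>"
  shows "R_lift r Z \<noteq> -\<infinity>"
  using R_sum_ninf[of r "fst Z", OF assms] by (simp add: R_lift_def ind0_def)

lemma subgrad_R_lift_closed:
  fixes r :: "'m::finite \<Rightarrow> real^'d::finite \<Rightarrow> ereal"
  assumes r: "\<And>i. proper_fun (r i)" "\<And>i. lsc_fun (r i)"
    and sub: "\<And>n. subgrad (R_lift r) (xs n) (ss n)"
    and lim: "xs \<longlonglongrightarrow> z" "ss \<longlonglongrightarrow> t"
  shows "subgrad (R_lift r) z t"
proof -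
  have ninf: "\<And>i z. r i z \<noteq> -\<infinity>" using r(1) by (simp add: proper_fun_def)
  note iff = subgrad_R_lift_iff[of r, OF ninf]
  have "(\<lambda>n. snd (xs n)) \<longlonglongrightarrow> snd z" by (intro tendsto_intros lim)
  moreover have "snd (xs n) = 0" for n using sub[of n] by (simp add: iff)
  ultimately have "snd z = 0" by (simp add: LIMSEQ_const_iff)
  moreover have "subgrad (r i) (fst z $ i) (fst t $ i)" for i
  proof (rule subgrad_closed[OF r])
    show "(\<lambda>n. fst (xs n) $ i) \<longlonglongrightarrow> fst z $ i" "(\<lambda>n. fst (ss n) $ i) \<longlonglongrightarrow> fst t $ i"
      by (intro tendsto_intros lim)+
    show "subgrad (r i) (fst (xs n) $ i) (fst (ss n) $ i)" for n
      using sub[of n] by (simp add: iff)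
  qed
  ultimately show ?thesis by (simp add: iff)
qed

lemma F_sum_tangent:
  fixes X Z :: "real^'d::finite^'m::finite"
  assumes "\<And>i. convex_on UNIV (f i)" "\<And>i. locally_smooth (f i)"
  shows "F_sum f X + F_grad f X \<bullet> (Z - X) \<le> F_sum f Z"
proof -
  have "(\<Sum>i\<in>UNIV. f i (X $ i) + grad (f i) (X $ i) \<bullet> (Z $ i - X $ i)) \<le> (\<Sum>i\<in>UNIV. f i (Z $ i))"
    using assms by (intro sum_mono convex_tangent) (auto simp: locally_smooth_def)
  then show ?thesis by (simp add: F_sum_def F_grad_def inner_vec_def[of "vec_lambda _"] sum.distrib)
qed

lemma isCont_F_grad:
  assumes "\<And>i. locally_smooth (f i)"
  shows "isCont (F_grad f) (X :: real^'d::finite^'m::finite)"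
  unfolding F_grad_def isCont_def
  by (intro tendsto_vec_lambda isCont_tendsto_compose[OF locally_smooth_isCont_grad[OF assms]]
      tendsto_intros tendsto_ident_at)

section \<open>The local Lipschitz constant and the rate bound\<close>

text \<open>The local Lipschitz constants of the rows add up to one for the whole matrix, and a
  locally Lipschitz map is Lipschitz on a compact set.\<close>

lemma F_grad_lipschitz_on_compact:
  fixes f :: "'m::finite \<Rightarrow> real^'d::finite \<Rightarrow> real"
  assumes smooth: "\<And>i. locally_smooth (f i)" and "compact U"
  shows "\<exists>L. L-lipschitz_on U (F_grad f)"
proof -
  \<comment> \<open>\<open>local_lipschitz\<close> concerns families with a time parameter; a single
    time instant turns it into a statement about one map.\<close>
  have "local_lipschitz {0::real} UNIV (\<lambda>_. F_grad f)"
  proof (rule local_lipschitzI)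
    fix X :: "real^'d^'m"
    have "\<exists>e>0. \<exists>L. L-lipschitz_on (cball (X $ i) e) (grad (f i))" for i
      using smooth[of i] unfolding locally_smooth_def by blast
    then obtain e L where e: "\<And>i. 0 < e i" and L: "\<And>i. (L i)-lipschitz_on (cball (X $ i) (e i)) (grad (f i))"
      by metis
    define u where "u = Min (range e)"
    have u: "0 < u" "\<And>i. u \<le> e i" using e by (auto simp: u_def)
    have "(\<Sum>i\<in>UNIV. L i)-lipschitz_on (cball X u) (F_grad f)"
    proof (rule lipschitz_onI)
      fix Y Z assume YZ: "Y \<in> cball X u" "Z \<in> cball X u"
      have "dist (F_grad f Y) (F_grad f Z) \<le> (\<Sum>i\<in>UNIV. dist (F_grad f Y $ i) (F_grad f Z $ i))"
        unfolding dist_vec_def by (rule L2_set_le_sum) auto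
      also have "\<dots> \<le> (\<Sum>i\<in>UNIV. L i * dist Y Z)"
      proof (rule sum_mono)
        fix i
        have "Y $ i \<in> cball (X $ i) (e i)" "Z $ i \<in> cball (X $ i) (e i)"
          using YZ u(2)[of i] dist_vec_nth_le[of X i Y] dist_vec_nth_le[of X i Z] by auto
        then have "dist (F_grad f Y $ i) (F_grad f Z $ i) \<le> L i * dist (Y $ i) (Z $ i)"
          using lipschitz_onD[OF L[of i]] by (simp add: F_grad_def)
        also have "\<dots> \<le> L i * dist Y Z"
          using lipschitz_on_nonneg[OF L[of i]] by (intro mult_left_mono dist_vec_nth_le)
        finally show "dist (F_grad f Y $ i) (F_grad f Z $ i) \<le> L i * dist Y Z" .
      qed
      finally show "dist (F_grad f Y) (F_grad f Z) \<le> (\<Sum>i\<in>UNIV. L i) * dist Y Z"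
        by (simp add: sum_distrib_right)
    qed (intro sum_nonneg lipschitz_on_nonneg[OF L])
    then show "\<exists>u>0. \<exists>L. \<forall>t\<in>cball t u \<inter> {0}. L-lipschitz_on (cball X u \<inter> UNIV) (F_grad f)" for t :: real
      using u(1) by auto
  qed
  then have "local_lipschitz {0::real} U (\<lambda>_. F_grad f)"
    by (rule local_lipschitz_subset) auto
  from local_lipschitz_compact_implies_lipschitz[OF this \<open>compact U\<close> _ continuous_on_const]
  show ?thesis by (metis compact_sing singletonI)
qed

text \<open>The infimum in \<open>lip_const\<close> is informative only over a nonempty set. The
  hull of finitely many segments is compact, so some Lipschitz constant exists, and all of them are
  nonnegative.\<close>

lemma L_local_nonneg:
  fixes f :: "'m::finite \<Rightarrow> real^'d::finite \<Rightarrow> real"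
  assumes "\<And>i. locally_smooth (f i)"
  shows "0 \<le> L_local f X A k"
proof -
  let ?U = "convex hull (\<Union>t<k. closed_segment (X t) (A (Suc t)))"
  have "compact ?U" by (intro compact_convex_hull compact_UN) auto
  with assms have "\<exists>L. L-lipschitz_on ?U (F_grad f)" by (rule F_grad_lipschitz_on_compact)
  then have "{L. L-lipschitz_on ?U (F_grad f)} \<noteq> {}" by simp
  then show ?thesis
    unfolding L_local_def lip_const_def
    by (rule cInf_greatest) (simp add: lipschitz_on_nonneg)
qed

text \<open>The minimum in the denominator is at most \<open>a0\<close> and the term with
  \<open>V\<close> is nonnegative. For \<open>L = 0\<close> the quotient with
  \<open>\<delta>\<close> is infinite and the minimum equals \<open>a0\<close>.\<close>

lemma rate_bound_ge:
  assumes "0 \<le> C" "0 \<le> V" "0 < a0" "0 < \<delta>" "0 \<le> L"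
  shows "ereal (1 / real n) * (C / ereal (2 * a0)) \<le> rate_bound C aK alow V a0 \<delta> L n"
proof -
  define m where "m = min (ereal a0) (ereal \<delta> / ereal (2 * L))"
  have "\<exists>b. m = ereal b \<and> 0 < b \<and> b \<le> a0"
  proof (cases "L = 0")
    case True
    then have "m = ereal a0" using assms by (simp add: m_def divide_ereal_def)
    then show ?thesis using assms by auto
  next
    case False
    then have "m = ereal (min a0 (\<delta> / (2 * L)))" using assms by (auto simp: m_def min_def)
    then show ?thesis
      using assms False by (intro exI[of _ "min a0 (\<delta> / (2 * L))"]) auto
  qed
  then obtain b where b: "m = ereal b" "0 < b" "b \<le> a0" by blast
  define C' where "C' = C + ereal ((1 + aK * sqrt (20 / alow\<^sup>2 + 3))\<^sup>2 * V)"
  have "C \<le> C'" unfolding C'_def using assms by (cases C) (auto intro!: mult_nonneg_nonneg)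
  have "C / ereal (2 * a0) \<le> C' / ereal (2 * a0)"
    using \<open>C \<le> C'\<close> assms by (intro ereal_divide_right_mono) auto
  also have "\<dots> = C' * ereal (1 / (2 * a0))"
    using assms by (simp add: divide_ereal_def inverse_eq_divide)
  also have "\<dots> \<le> C' * ereal (1 / (2 * b))"
    using b assms \<open>C \<le> C'\<close> by (intro ereal_mult_left_mono) (auto simp: frac_le)
  also have "\<dots> = C' / (2 * m)"
    using b by (simp add: divide_ereal_def inverse_eq_divide)
  finally show ?thesis
    unfolding rate_bound_def C'_def m_def by (intro ereal_mult_left_mono) auto
qed

section \<open>Convergence and rate of the lifted algorithm\<close>

theorem theorem4p4:
  fixes f :: "'m::finite \<Rightarrow> real^'d::finite \<Rightarrow> real"
    and r :: "'m \<Rightarrow> real^'d \<Rightarrow> ereal"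
    and E :: "('m \<times> 'm) set"
    and Wt W Q M :: "real^'m^'m"
    and c \<eta> \<delta> alow :: real
    and \<mu> :: "nat \<Rightarrow> real"
    and a :: "nat \<Rightarrow> 'm \<Rightarrow> real"
    and X S D A Y :: "nat \<Rightarrow> real^'d^'m"
  assumes f_convex: "\<And>i. convex_on UNIV (f i)"
    and f_smooth: "\<And>i. locally_smooth (f i)"
    and r_proper: "\<And>i. proper_fun (r i)"
    and r_convex: "\<And>i. convex_fun (r i)"
    and r_lsc: "\<And>i. lsc_fun (r i)"
    and u_bounded_below:
      "\<exists>b::real. \<forall>x. ereal b \<le> ereal (\<Sum>i\<in>UNIV. f i x) + (\<Sum>i\<in>UNIV. r i x)"
    and graph: "connected_graph E"
    and gossip: "gossip_matrix E Wt"
    and c: "0 < c" "c < 1 / 2"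
    and W: "W = (1 - c) *\<^sub>R mat 1 + c *\<^sub>R Wt"
    and Q: "psd_root Q (mat 1 - W)"
    and M: "psd_root M W"
    and saddle_exists: "saddle_points (lagrangian f r Q M) \<noteq> {}"
    and params: "0 < \<eta>" "\<eta> < 1" "0 < \<delta>" "\<delta> < 1"
    and \<mu>: "\<And>k. 0 \<le> \<mu> k" "summable \<mu>"
    and run: "algorithm_run f r E W \<eta> \<delta> \<mu> a X S D A"
    and Y: "Y_run f Q a X S D Y"
    and alow: "0 < alow" "\<And>k. alow \<le> a_min a (Suc k)"
  shows
    "(\<exists>Zs Ts. (Zs, Ts) \<in> saddle_points (lagrangian f r Q M) \<and>
        (\<lambda>k. (X_lift X k, S_lift M S Y k)) \<longlonglongrightarrow> (Zs, Ts)) \<and>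
     (\<forall>Zs Ts. (Zs, Ts) \<in> saddle_points (lagrangian f r Q M) \<longrightarrow>
        (\<exists>B\<^sub>X B\<^sub>S. \<exists>K\<ge>1.
           bounded (B\<^sub>X \<times> B\<^sub>S) \<and>
           (Zs, Ts) \<in> B\<^sub>X \<times> B\<^sub>S \<and>
           (\<forall>k\<ge>K. (A_lift M a A Y k, S_lift M S Y k) \<in> interior (B\<^sub>X \<times> B\<^sub>S)) \<and>
           (\<forall>k>K.
              gap (lagrangian f r Q M) B\<^sub>X B\<^sub>S
                (ergodic_avg (a_min a) K (A_lift M a A Y) k)
                (ergodic_avg (a_min a) K (S_lift M S Y) k)
              \<le> rate_bound
                   (C_const a (lagrangian f r Q M) B\<^sub>X B\<^sub>S (A_lift M a A Y) (S_lift M S Y) K)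
                   (a_min a K) alow
                   (V_dist a (X_lift X) (S_lift M S Y) K Zs Ts)
                   (a_min a 0) \<delta> (L_local f X A k) (k - K))))"
proof -
  define w where "w = a_min a"
  define V :: "((real^'d^'m) \<times> (real^'d^'m)) set" where "V = {Z. Q ** fst Z + M ** snd Z = 0}"
  \<comment> \<open>The exponent that backtracking selects, before the min-consensus.\<close>
  define j where "j k i = (LEAST n. descent_test (f i) \<delta> (X k $ i) ((W ** X k) $ i)
      ((W ** (F_grad f (X k) + S k + D k)) $ i) (\<eta> ^ n * sqrt ((a k i)\<^sup>2 + \<mu> k)))" for k i
  have a0: "0 < a 0 i" for i
    using run by (simp add: algorithm_run_def)
  have amin_le: "a_min a k \<le> a k i" for k i
    by (simp add: a_min_def)
  have a_lo: "alow \<le> a (Suc k) i" for k i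
    using alow(2)[of k] amin_le[of "Suc k" i] by linarith
  have a_pos: "0 < a k i" for k i
    using a0 alow(1) a_lo[of _ i] by (cases k) (auto intro: less_le_trans)
  have a_Suc: "a (Suc k) i = Min ((\<lambda>l. \<eta> ^ j k l * sqrt ((a k l)\<^sup>2 + \<mu> k)) ` nbhd E i)" for k i
    using run by (simp add: algorithm_run_def Let_def backtrack_def j_def)
  have A_Suc: "A (Suc k) = W ** X k - diag_mat (a (Suc k)) ** (W ** (F_grad f (X k) + S k + D k))"
    and X_Suc: "X (Suc k) = R_prox (a (Suc k)) r (A (Suc k) + diag_mat (a (Suc k)) ** S k)"
    and S_Suc: "S (Suc k) = S k + diag_mat (\<lambda>i. 1 / a (Suc k) i) ** (A (Suc k) - X (Suc k))"
    and D_Suc: "D (Suc k) = W ** (F_grad f (X k) + S k + D k)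
        + (mat 1 - W) ** (diag_mat (\<lambda>i. 1 / a (Suc k) i) ** X k) - F_grad f (X k) - S k" for k
    using run by (simp_all add: algorithm_run_def Let_def)
  have Y_Suc: "Y (Suc k) =
      Y k + Q ** (diag_mat (\<lambda>i. 1 / a (Suc k) i) ** X k - S k - D k - F_grad f (X k))" for k
    using Y by (simp add: Y_run_def)
  have Q2: "Q ** (Q ** U) = (mat 1 - W) ** U" for U :: "real^'d^'m"
    using Q by (simp add: psd_root_def matrix_mul_assoc)
  \<comment> \<open>Both recursions start at 0, and applying \<open>Q\<close> to that of
    \<open>Y\<close> gives that of \<open>D\<close>, because \<open>I - W\<close> is the square of
    \<open>Q\<close>.\<close>
  have D_eq: "D k = Q ** Y k" for k
  proof (induction k)
    case 0
    then show ?case using run Y by (simp add: algorithm_run_def Y_run_def matrix_mult_zero)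
  next
    case (Suc k)
    have "Q ** Y (Suc k) = D k + (mat 1 - W) ** (diag_mat (\<lambda>i. 1 / a (Suc k) i) ** X k - S k - D k - F_grad f (X k))"
      by (simp only: Suc Y_Suc matrix_mult_add Q2)
    then show ?case
      by (simp add: D_Suc matrix_mult_add matrix_mult_diff matrix_diff_mult algebra_simps)
  qed
  have ninf: "\<And>i z. r i z \<noteq> -\<infinity>" using r_proper by (simp add: proper_fun_def)
  \<comment> \<open>Prox optimality, row by row with each agent's own stepsize, so valid from the
    first iteration on.\<close>
  have sub: "subgrad (R_lift r) (X_lift X (Suc k)) (S_lift M S Y (Suc k))" for k
  proof -
    have "subgrad (r i) (X (Suc k) $ i) (S (Suc k) $ i)" for i
    proof -
      define z where "z = A (Suc k) $ i + a (Suc k) i *\<^sub>R (S k $ i)"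
      have Xi: "X (Suc k) $ i = prox (a (Suc k) i) (r i) z"
        by (subst X_Suc) (simp add: R_prox_def diag_mat_mult_row z_def)
      have "S (Suc k) $ i = (1 / a (Suc k) i) *\<^sub>R (z - X (Suc k) $ i)"
        using a_pos[of "Suc k" i]
        by (subst S_Suc) (simp add: diag_mat_mult_row z_def algebra_simps)
      then show ?thesis
        using prox_subgrad[OF r_proper r_convex r_lsc a_pos] Xi by simp
    qed
    then show ?thesis by (simp add: subgrad_R_lift_iff[OF ninf] X_lift_def S_lift_def)
  qed
  obtain N where N1: "1 \<le> N" and N: "\<And>k i. N \<le> k \<Longrightarrow> j k i = 0" "\<And>k i l. N \<le> k \<Longrightarrow> a k i = a k l"
    using consensus_stepsizes[OF graph params(1,2) \<mu> alow(1) a_lo a0 a_Suc] by blast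
  have a_eq: "a k i = w k" if "N \<le> k" for k i
  proof -
    have "range (a k) = {a k i}" using N(2)[OF that] by auto
    then show ?thesis by (simp add: w_def a_min_def)
  qed
  have w_Suc: "w (Suc k) = sqrt ((w k)\<^sup>2 + \<mu> k)" if k: "N \<le> k" for k
  proof -
    fix i :: 'm
    have "(\<lambda>l. \<eta> ^ j k l * sqrt ((a k l)\<^sup>2 + \<mu> k)) ` nbhd E i = {sqrt ((w k)\<^sup>2 + \<mu> k)}"
      using N(1)[OF k] a_eq[OF k] by (auto simp: nbhd_def)
    then show ?thesis using a_Suc[of k i] a_eq[of "Suc k" i] k by simp
  qed
  have w_gt_0: "0 < w k" for k
    unfolding w_def a_min_def using a_pos by (subst Min_gr_iff) auto
  have w_sq: "(w (Suc k))\<^sup>2 = (w k)\<^sup>2 + \<mu> k" if "N \<le> k" for k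
    using w_Suc[OF that] \<mu>(1)[of k] by simp
  define hi where "hi = sqrt ((w N)\<^sup>2 + suminf \<mu>)"
  have w_hi: "w k \<le> hi" if "N \<le> k" for k
  proof -
    \<comment> \<open>From \<open>N\<close> on the common squared stepsize grows exactly by the
      added \<open>\<mu>\<close> terms, so it stays below its value at \<open>N\<close> plus their
      total.\<close>
    have "(w k)\<^sup>2 + (\<Sum>t<N. \<mu> t) = (w N)\<^sup>2 + (\<Sum>t<k. \<mu> t)"
      using that by (induction k rule: dec_induct) (auto simp: w_sq)
    moreover have "(\<Sum>t<k. \<mu> t) \<le> suminf \<mu>" using \<mu> by (intro sum_le_suminf) auto
    moreover have "0 \<le> (\<Sum>t<N. \<mu> t)" using \<mu>(1) by (intro sum_nonneg)
    ultimately have "(w k)\<^sup>2 \<le> (w N)\<^sup>2 + suminf \<mu>" by linarith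
    then show ?thesis unfolding hi_def by (rule real_le_rsqrt)
  qed
  have w_mono: "w k \<le> w (Suc k)" if "N \<le> k" for k
    unfolding w_Suc[OF that] using \<mu>(1)[of k] by (intro real_le_rsqrt) simp
  have diag: "diag_mat (a (Suc k)) ** U = w (Suc k) *\<^sub>R U"
    and diag_inv: "diag_mat (\<lambda>i. 1 / a (Suc k) i) ** U = (1 / w (Suc k)) *\<^sub>R U"
    if "N \<le> k" for k and U :: "real^'d^'m"
    using a_eq[of "Suc k"] that by (simp_all add: vec_eq_iff[of "_ ** _"] diag_mat_mult_row)
  have A_lift_Suc: "A_lift M a A Y (Suc k) = (A (Suc k), w (Suc k) *\<^sub>R (M ** (Y k - Y (Suc k))))"
    if "N \<le> k" for k
    using diag[OF that] by (simp add: A_lift_def)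
  have proj: "Q ** A (Suc k) + M ** (w (Suc k) *\<^sub>R (M ** (Y k - Y (Suc k)))) = 0"
    and orth: "Q ** Z + M ** Z' = 0 \<Longrightarrow>
      (X k - w (Suc k) *\<^sub>R (F_grad f (X k) + S k) - A (Suc k)) \<bullet> Z
      + (w (Suc k) *\<^sub>R (M ** Y k) - w (Suc k) *\<^sub>R (M ** (Y k - Y (Suc k)))) \<bullet> Z' = 0"
    if k: "N \<le> k" for k Z Z'
  proof -
    have Y': "Y (Suc k) = Y k + Q ** ((1 / w (Suc k)) *\<^sub>R X k - S k - D k - F_grad f (X k))"
      using Y_Suc[of k] diag_inv[OF k] by simp
    have A': "A (Suc k) = W ** X k - w (Suc k) *\<^sub>R (W ** (F_grad f (X k) + S k + D k))"
      using A_Suc[of k] diag[OF k] by simp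
    have "w (Suc k) \<noteq> 0" using w_gt_0[of "Suc k"] by simp
    note * = lifted_projection_step[OF Q M this D_eq Y' A']
    show "Q ** A (Suc k) + M ** (w (Suc k) *\<^sub>R (M ** (Y k - Y (Suc k)))) = 0" by (rule *(1))
    show "Q ** Z + M ** Z' = 0 \<Longrightarrow>
      (X k - w (Suc k) *\<^sub>R (F_grad f (X k) + S k) - A (Suc k)) \<bullet> Z
      + (w (Suc k) *\<^sub>R (M ** Y k) - w (Suc k) *\<^sub>R (M ** (Y k - Y (Suc k)))) \<bullet> Z' = 0" by (rule *(2))
  qed
  \<comment> \<open>From \<open>N\<close> on the tested stepsize, the one after consensus and
    \<open>w (Suc k)\<close> coincide, so each row of \<open>A (Suc k)\<close> is the accepted trial
    point; the row inequalities are then added.\<close>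
  have descent: "F_sum f (A (Suc k)) \<le> F_sum f (X k) + F_grad f (X k) \<bullet> (A (Suc k) - X k)
      + \<delta> / (2 * w (Suc k)) * (norm (A (Suc k) - X k))\<^sup>2" if k: "N \<le> k" for k
  proof -
    have "f i (A (Suc k) $ i) \<le> f i (X k $ i) + F_grad f (X k) $ i \<bullet> (A (Suc k) - X k) $ i
        + \<delta> / (2 * w (Suc k)) * (norm ((A (Suc k) - X k) $ i))\<^sup>2" for i
    proof -
      have "0 < sqrt ((a k i)\<^sup>2 + \<mu> k)" using a_pos[of k i] \<mu>(1)[of k] by (simp add: add_pos_nonneg)
      then have "\<exists>n. descent_test (f i) \<delta> (X k $ i) ((W ** X k) $ i)
          ((W ** (F_grad f (X k) + S k + D k)) $ i) (\<eta> ^ n * sqrt ((a k i)\<^sup>2 + \<mu> k))"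
        using f_convex f_smooth params by (intro exists_backtracking_step)
      then have "descent_test (f i) \<delta> (X k $ i) ((W ** X k) $ i)
          ((W ** (F_grad f (X k) + S k + D k)) $ i) (\<eta> ^ j k i * sqrt ((a k i)\<^sup>2 + \<mu> k))"
        unfolding j_def by (rule LeastI_ex)
      moreover have "\<eta> ^ j k i * sqrt ((a k i)\<^sup>2 + \<mu> k) = w (Suc k)"
        using N(1)[OF k] a_eq[OF k] w_Suc[OF k] by simp
      moreover have "(W ** X k) $ i - w (Suc k) *\<^sub>R ((W ** (F_grad f (X k) + S k + D k)) $ i) = A (Suc k) $ i"
        unfolding A_Suc[of k] diag[OF k] by simp
      ultimately show ?thesis
        by (simp add: descent_test_def Let_def F_grad_def)
    qed
    then have "(\<Sum>i\<in>UNIV. f i (A (Suc k) $ i)) \<le> (\<Sum>i\<in>UNIV. f i (X k $ i) + F_grad f (X k) $ i \<bullet> (A (Suc k) - X k) $ i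
        + \<delta> / (2 * w (Suc k)) * (norm ((A (Suc k) - X k) $ i))\<^sup>2)"
      by (rule sum_mono)
    then show ?thesis
      unfolding power2_norm_eq_inner
      by (simp only: F_sum_def inner_vec_def[where 'a = "real^'d" and 'b = 'm] sum.distrib sum_distrib_left)
  qed
  \<comment> \<open>The smooth part depends on the first block only, so the second block of its
    gradient is 0.\<close>
  interpret splitting_run "\<lambda>Z. F_sum f (fst Z)" "\<lambda>Z. (F_grad f (fst Z), 0)" V "R_lift r"
    "X_lift X" "S_lift M S Y" "A_lift M a A Y" w N \<delta> alow hi
  proof unfold_locales
    show "F_sum f (fst y) + (F_grad f (fst y), 0) \<bullet> (z - y) \<le> F_sum f (fst z)"
      for y z :: "(real^'d^'m) \<times> (real^'d^'m)"
      using F_sum_tangent[OF f_convex f_smooth] by (simp add: inner_prod_def)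
    show "subspace V"
      by (auto simp: subspace_def V_def matrix_mult_zero matrix_mult_add matrix_mult_scale
          add_ac simp flip: scaleR_right_distrib)
    show "R_lift r z \<noteq> -\<infinity>" for z by (rule R_lift_ninf[OF ninf])
    show "\<exists>z T. subgrad (R_lift r) z T" using sub by blast
    show "isCont (\<lambda>Z. (F_grad f (fst Z), 0)) z" for z :: "(real^'d^'m) \<times> (real^'d^'m)"
      by (intro continuous_intros isCont_o2[OF _ isCont_F_grad[OF f_smooth]])
    show "subgrad (R_lift r) z t" if "\<And>n. subgrad (R_lift r) (xs n) (ss n)" "xs \<longlonglongrightarrow> z" "ss \<longlonglongrightarrow> t"
      for xs ss z t
      using r_proper r_lsc that by (rule subgrad_R_lift_closed)
    show "\<delta> < 1" "0 < alow" "1 \<le> N" by fact+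
    show "alow \<le> w k" if "1 \<le> k" for k using alow(2)[of "k - 1"] that by (simp add: w_def)
    show "w k \<le> hi" "w k \<le> w (Suc k)" if "N \<le> k" for k using w_hi w_mono that by auto
    fix k assume k: "N \<le> k"
    show "A_lift M a A Y (Suc k) \<in> V" using proj[OF k] by (simp add: A_lift_Suc[OF k] V_def)
    show "(X_lift X k - w (Suc k) *\<^sub>R ((F_grad f (fst (X_lift X k)), 0) + S_lift M S Y k) - A_lift M a A Y (Suc k)) \<bullet> z = 0"
      if "z \<in> V" for z
      using orth[OF k, of "fst z" "snd z"] that
      by (simp add: A_lift_Suc[OF k] V_def X_lift_def S_lift_def inner_prod_def)
    show "S_lift M S Y (Suc k) = S_lift M S Y k + (1 / w (Suc k)) *\<^sub>R (A_lift M a A Y (Suc k) - X_lift X (Suc k))"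
      using S_Suc[of k] diag_inv[OF k] w_gt_0[of "Suc k"]
      by (simp add: A_lift_Suc[OF k] X_lift_def S_lift_def matrix_mult_diff scaleR_right_diff_distrib)
    show "subgrad (R_lift r) (X_lift X (Suc k)) (S_lift M S Y (Suc k))" by (rule sub)
    \<comment> \<open>The second block of the lifted step only adds to the norm, which weakens the
      descent inequality in the right direction.\<close>
    have "(norm (A (Suc k) - X k))\<^sup>2 \<le> (norm (A_lift M a A Y (Suc k) - X_lift X k))\<^sup>2"
      by (simp add: A_lift_Suc[OF k] X_lift_def norm_Pair)
    then have "\<delta> / (2 * w (Suc k)) * (norm (A (Suc k) - X k))\<^sup>2
        \<le> \<delta> / (2 * w (Suc k)) * (norm (A_lift M a A Y (Suc k) - X_lift X k))\<^sup>2"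
      using params w_gt_0[of "Suc k"] by (intro mult_left_mono) auto
    then show "F_sum f (fst (A_lift M a A Y (Suc k))) \<le> F_sum f (fst (X_lift X k))
        + (F_grad f (fst (X_lift X k)), 0) \<bullet> (A_lift M a A Y (Suc k) - X_lift X k)
        + \<delta> / (2 * w (Suc k)) * (norm (A_lift M a A Y (Suc k) - X_lift X k))\<^sup>2"
      using descent[OF k] by (simp add: A_lift_def X_lift_def inner_prod_def)
  qed
  have lagr: "lagrangian f r Q M = Lag"
  proof (intro ext)
    fix Z T :: "(real^'d^'m) \<times> (real^'d^'m)"
    have "G_lift Q M Z = (if Z \<in> V then 0 else \<infinity>)" by (simp add: G_lift_def ind0_def V_def)
    then show "lagrangian f r Q M Z T = Lag Z T" by (simp add: lagrangian_def Lag_def)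
  qed
  obtain Z T where sad: "(Z, T) \<in> saddle_points Lag" and lim: "X_lift X \<longlonglongrightarrow> Z" "S_lift M S Y \<longlonglongrightarrow> T"
    using converges_to_saddle saddle_exists unfolding lagr by metis
  show ?thesis
    unfolding lagr
  proof (intro conjI allI impI)
    show "\<exists>Zs Ts. (Zs, Ts) \<in> saddle_points Lag \<and> (\<lambda>k. (X_lift X k, S_lift M S Y k)) \<longlonglongrightarrow> (Zs, Ts)"
      using sad lim by (intro exI[of _ Z] exI[of _ T] conjI tendsto_Pair)
    fix Zs Ts assume sad': "(Zs, Ts) \<in> saddle_points Lag"
    \<comment> \<open>The free parameter \<open>a0\<close> of the abstract rate becomes
      \<open>w 0\<close>, the smallest initial stepsize.\<close>
    obtain B C K where K: "1 \<le> K" and BC: "bounded (B \<times> C)" "(Zs, Ts) \<in> B \<times> C"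
        "\<forall>k\<ge>K. (A_lift M a A Y k, S_lift M S Y k) \<in> interior (B \<times> C)"
      and rate: "\<And>k. K < k \<Longrightarrow> gap Lag B C (ergodic_avg w K (A_lift M a A Y) k) (ergodic_avg w K (S_lift M S Y) k)
        \<le> ereal (1 / real (k - K)) *
          (2 * (\<Sum>j=1..K. ereal (w j) * gap Lag B C (A_lift M a A Y j) (S_lift M S Y j)) / ereal (2 * w 0))"
      using ergodic_rate[OF sad lim sad' w_gt_0[of 0]] by blast
    define Cc where "Cc = C_const a Lag B C (A_lift M a A Y) (S_lift M S Y) K"
    have Cc_eq: "Cc = 2 * (\<Sum>j=1..K. ereal (w j) * gap Lag B C (A_lift M a A Y j) (S_lift M S Y j))"
      by (simp add: Cc_def C_const_def w_def)
    have "0 \<le> ereal (w j) * gap Lag B C (A_lift M a A Y j) (S_lift M S Y j)" for j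
      using gap_nonneg[OF sad', of B C] BC(2) w_gt_0[of j] by auto
    then have "0 \<le> (\<Sum>j=1..K. ereal (w j) * gap Lag B C (A_lift M a A Y j) (S_lift M S Y j))"
      by (rule sum_nonneg)
    then have "0 \<le> Cc" unfolding Cc_eq by auto
    have bound: "gap Lag B C (ergodic_avg w K (A_lift M a A Y) k) (ergodic_avg w K (S_lift M S Y) k)
        \<le> rate_bound Cc (w K) alow (V_dist a (X_lift X) (S_lift M S Y) K Zs Ts) (w 0) \<delta> (L_local f X A k) (k - K)"
      if "K < k" for k
    proof -
      have "ereal (1 / real (k - K)) * (Cc / ereal (2 * w 0))
        \<le> rate_bound Cc (w K) alow (V_dist a (X_lift X) (S_lift M S Y) K Zs Ts) (w 0) \<delta> (L_local f X A k) (k - K)"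
        using \<open>0 \<le> Cc\<close> w_gt_0[of 0] params L_local_nonneg[OF f_smooth]
        by (intro rate_bound_ge) (auto simp: V_dist_def)
      with rate[OF that] show ?thesis unfolding Cc_eq by (rule order_trans)
    qed
    show "\<exists>B\<^sub>X B\<^sub>S. \<exists>K\<ge>1.
           bounded (B\<^sub>X \<times> B\<^sub>S) \<and>
           (Zs, Ts) \<in> B\<^sub>X \<times> B\<^sub>S \<and>
           (\<forall>k\<ge>K. (A_lift M a A Y k, S_lift M S Y k) \<in> interior (B\<^sub>X \<times> B\<^sub>S)) \<and>
           (\<forall>k>K.
              gap Lag B\<^sub>X B\<^sub>S
                (ergodic_avg (a_min a) K (A_lift M a A Y) k)
                (ergodic_avg (a_min a) K (S_lift M S Y) k)
              \<le> rate_bound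
                   (C_const a Lag B\<^sub>X B\<^sub>S (A_lift M a A Y) (S_lift M S Y) K)
                   (a_min a K) alow
                   (V_dist a (X_lift X) (S_lift M S Y) K Zs Ts)
                   (a_min a 0) \<delta> (L_local f X A k) (k - K))"
      using K BC bound unfolding w_def Cc_def
      by (intro exI[of _ B] exI[of _ C] exI[of _ K] conjI allI impI) simp_all
  qed
qed

end
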